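(* Let $n\geq 3$, $m\geq 2$, and let $(N^{m},\tilde g)$ be a Ricci-flat semi-Riemannian manifold. Let $(\mathbb{R}^{n},g)$ be the pseudo-Euclidean space with coordinates $x=(x_1,\ldots,x_n)$ and $g_{ij}=\delta_{ij}\varepsilon_i$, where $\varepsilon_i=\pm1$ and at least one $\varepsilon_i=1$. Let $\xi=\sum_{k=1}^{n}\alpha_k x_k$ with $\alpha_k\in\mathbb{R}$ and $\sum_{k}\varepsilon_k\alpha_k^{2}=\kappa=\pm1$. Let $I\subseteq\mathbb{R}$ be a nonempty open interval and $M=\{x\in\mathbb{R}^{n}:\xi(x)\in I\}$. Let $\psi=\psi(\xi)$ and $f=f(\xi)$ be smooth functions on $M$ depending only on $\xi$, with $\psi$ nowhere zero, $f>0$ and $f$ nonconstant, such that $\bar g=\frac{1}{\psi^{2}}g$ has constant scalar curvature (possibly zero) on $M$. Suppose that $(\widehat M^{n+m},\hat g)=(M,\bar g)\times_f(N^{m},\tilde g)$ is an Einstein warped product semi-Riemannian manifold, i.e. $\widehat{Ric}=\lambda\hat g$ with $\lambda$ constant. Then one of the following holds: (1) $\widehat M$ is Ricci-flat, its base is pseudo-Euclidean ($\psi$ is constant, so $\bar g$ is $g$ up to a constant rescaling), and the warping function is $f(\xi)=\Theta\exp(A\xi)$ with constants $\Theta>0$ and $A\neq0$; or (2) $\widehat M$ is conformal to the product of the pseudo-Euclidean space with $N$, namely, for some constant $\Theta>0$, $$\hat g=\varphi(\xi)\,\bigl(g+\Theta^{2}\tilde g\bigr),\qquad \varphi(\xi)=\frac{1}{(-G\xi+C)^{2}},$$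 where $G\neq0$ and $C$ are real constants; this conformal function is defined for $\xi\neq\frac{C}{G}$.
   Context: The warped product $(M,h)\times_f(N,\tilde g)$ is the product manifold $M\times N$ endowed with the metric $\hat g=h+f^{2}\tilde g$, where $f:M\to(0,+\infty)$ is smooth. $\widehat{Ric}$ is the Ricci tensor of $\hat g$. Saying that a function depends only on $\xi$ means that it is invariant under the $(n-1)$-dimensional group of translations preserving $\xi$. *)

theory Defs
  imports "HOL-Analysis.Analysis"
begin

definition partial_deriv :: "'d::finite \<Rightarrow> (real^'d \<Rightarrow> real) \<Rightarrow> real^'d \<Rightarrow> real" where
  "partial_deriv i u x = frechet_derivative u (at x) (axis i 1)"

text \<open>The next two notions are meant for open \<open>S\<close>; they depend only on the values of \<open>u\<close> on \<open>S\<close>.\<close>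

fun Ck_on :: "nat \<Rightarrow> (real^'d::finite) set \<Rightarrow> (real^'d \<Rightarrow> real) \<Rightarrow> bool" where
  "Ck_on 0 S u \<longleftrightarrow> continuous_on S u"
| "Ck_on (Suc k) S u \<longleftrightarrow>
     (\<forall>x\<in>S. u differentiable (at x)) \<and> (\<forall>i. Ck_on k S (partial_deriv i u))"

definition smooth_on :: "(real^'d::finite) set \<Rightarrow> (real^'d \<Rightarrow> real) \<Rightarrow> bool" where
  "smooth_on S u \<longleftrightarrow> (\<forall>k. Ck_on k S u)"

subsection \<open>Tensor calculus on open subsets of coordinate space\<close>

text \<open>Here \<open>G x $ i $ j\<close> are the components of a metric at the point with coordinates \<open>x\<close>.\<close>

definition christoffel :: "(real^'d::finite \<Rightarrow> real^'d^'d) \<Rightarrow> 'd \<Rightarrow> 'd \<Rightarrow> 'd \<Rightarrow> real^'d \<Rightarrow> real" where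
  "christoffel G k i j x =
     (1/2) * (\<Sum>l\<in>UNIV. matrix_inv (G x) $ k $ l *
        (partial_deriv i (\<lambda>y. G y $ j $ l) x + partial_deriv j (\<lambda>y. G y $ i $ l) x
         - partial_deriv l (\<lambda>y. G y $ i $ j) x))"

text \<open>\<open>riemann G l i j k\<close> is the \<open>l\<close>-component of
  \<open>R(\<partial>\<^sub>j, \<partial>\<^sub>k)\<partial>\<^sub>i = \<nabla>\<^sub>j\<nabla>\<^sub>k\<partial>\<^sub>i - \<nabla>\<^sub>k\<nabla>\<^sub>j\<partial>\<^sub>i\<close>; with the contraction below, round spheres have
  positive Ricci curvature.\<close>

definition riemann ::
    "(real^'d::finite \<Rightarrow> real^'d^'d) \<Rightarrow> 'd \<Rightarrow> 'd \<Rightarrow> 'd \<Rightarrow> 'd \<Rightarrow> real^'d \<Rightarrow> real" where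
  "riemann G l i j k x =
     partial_deriv j (christoffel G l i k) x - partial_deriv k (christoffel G l i j) x
     + (\<Sum>p\<in>UNIV. christoffel G l j p x * christoffel G p i k x
                  - christoffel G l k p x * christoffel G p i j x)"

definition ricci_coords :: "(real^'d::finite \<Rightarrow> real^'d^'d) \<Rightarrow> real^'d \<Rightarrow> real^'d^'d" where
  "ricci_coords G x = (\<chi> i k. \<Sum>l\<in>UNIV. riemann G l i l k x)"

subsection \<open>Semi-Riemannian manifolds\<close>

text \<open>The charts are indexed by the set \<open>charts\<close>.  A (0,2)-tensor field is given by its components
  in every chart: \<open>metr S c p $ i $ j\<close> is the value of the metric at the point \<open>p\<close> on the
  coordinate vectors \<open>\<partial>\<^sub>i, \<partial>\<^sub>j\<close> of the chart \<open>c\<close>.\<close>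

record ('p, 'c, 'd::finite) semi_riem =
  topo :: "'p topology"
  charts :: "'c set"
  chart_dom :: "'c \<Rightarrow> 'p set"
  coord :: "'c \<Rightarrow> 'p \<Rightarrow> real^'d"
  metr :: "'c \<Rightarrow> 'p \<Rightarrow> real^'d^'d"

definition chart_inv :: "('p, 'c, 'd::finite) semi_riem \<Rightarrow> 'c \<Rightarrow> real^'d \<Rightarrow> 'p" where
  "chart_inv S c = inv_into (chart_dom S c) (coord S c)"

definition smooth_manifold :: "('p, 'c, 'd::finite) semi_riem \<Rightarrow> bool" where
  "smooth_manifold S \<longleftrightarrow>
     topspace (topo S) \<noteq> {} \<and> Hausdorff_space (topo S) \<and> second_countable (topo S) \<and>
     (\<Union>c\<in>charts S. chart_dom S c) = topspace (topo S) \<and>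
     (\<forall>c\<in>charts S. openin (topo S) (chart_dom S c) \<and> open (coord S c ` chart_dom S c) \<and>
        homeomorphic_map (subtopology (topo S) (chart_dom S c))
          (top_of_set (coord S c ` chart_dom S c)) (coord S c)) \<and>
     (\<forall>c\<in>charts S. \<forall>d\<in>charts S. \<forall>i.
        smooth_on (coord S c ` (chart_dom S c \<inter> chart_dom S d))
          (\<lambda>x. coord S d (chart_inv S c x) $ i))"

text \<open>The index: the largest dimension of a subspace on which the form is negative definite.\<close>

definition form_index :: "real^'d^'d::finite \<Rightarrow> nat" where
  "form_index A = Max (dim ` {W :: (real^'d) set. subspace W \<and> (\<forall>v\<in>W. v \<noteq> 0 \<longrightarrow> v \<bullet> (A *v v) < 0)})"

definition semi_riemannian_manifold :: "('p, 'c, 'd::finite) semi_riem \<Rightarrow> bool" where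
  "semi_riemannian_manifold S \<longleftrightarrow>
     smooth_manifold S \<and>
     (\<forall>c\<in>charts S. \<forall>p\<in>chart_dom S c.
        transpose (metr S c p) = metr S c p \<and> invertible (metr S c p)) \<and>
     (\<exists>\<nu>. \<forall>c\<in>charts S. \<forall>p\<in>chart_dom S c. form_index (metr S c p) = \<nu>) \<and>
     (\<forall>c\<in>charts S. \<forall>i j.
        smooth_on (coord S c ` chart_dom S c) (\<lambda>x. metr S c (chart_inv S c x) $ i $ j)) \<and>
     (\<forall>c\<in>charts S. \<forall>d\<in>charts S. \<forall>p\<in>chart_dom S c \<inter> chart_dom S d.
        (let J = matrix (frechet_derivative (coord S d \<circ> chart_inv S c) (at (coord S c p)))
         in metr S c p = transpose J ** metr S d p ** J))"

definition ricci :: "('p, 'c, 'd::finite) semi_riem \<Rightarrow> 'c \<Rightarrow> 'p \<Rightarrow> real^'d^'d" where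
  "ricci S c p = ricci_coords (\<lambda>x. metr S c (chart_inv S c x)) (coord S c p)"

definition scalar_curvature :: "('p, 'c, 'd::finite) semi_riem \<Rightarrow> 'c \<Rightarrow> 'p \<Rightarrow> real" where
  "scalar_curvature S c p =
     (\<Sum>i\<in>UNIV. \<Sum>j\<in>UNIV. matrix_inv (metr S c p) $ i $ j * ricci S c p $ i $ j)"

definition constant_scalar_curvature :: "('p, 'c, 'd::finite) semi_riem \<Rightarrow> bool" where
  "constant_scalar_curvature S \<longleftrightarrow>
     (\<exists>s. \<forall>c\<in>charts S. \<forall>p\<in>chart_dom S c. scalar_curvature S c p = s)"

definition einstein :: "('p, 'c, 'd::finite) semi_riem \<Rightarrow> real \<Rightarrow> bool" where
  "einstein S l \<longleftrightarrow> (\<forall>c\<in>charts S. \<forall>p\<in>chart_dom S c. ricci S c p = l *\<^sub>R metr S c p)"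

definition ricci_flat :: "('p, 'c, 'd::finite) semi_riem \<Rightarrow> bool" where
  "ricci_flat S \<longleftrightarrow> (\<forall>c\<in>charts S. \<forall>p\<in>chart_dom S c. ricci S c p = 0)"

subsection \<open>The constructions used\<close>

definition pseudo_euclidean ::
    "(real^'n::finite) set \<Rightarrow> ('n \<Rightarrow> real) \<Rightarrow> (real^'n, unit, 'n) semi_riem" where
  "pseudo_euclidean M \<epsilon> =
     \<lparr>topo = top_of_set M, charts = {()}, chart_dom = (\<lambda>_. M), coord = (\<lambda>_ x. x),
      metr = (\<lambda>_ _. \<chi> i j. if i = j then \<epsilon> i else 0)\<rparr>"

definition conformal_change ::
    "('p \<Rightarrow> real) \<Rightarrow> ('p, 'c, 'd::finite) semi_riem \<Rightarrow> ('p, 'c, 'd) semi_riem" where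
  "conformal_change u S = S\<lparr>metr := (\<lambda>c p. u p *\<^sub>R metr S c p)\<rparr>"

text \<open>The product manifold with product charts (coordinates of the base are indexed by \<open>Inl\<close>,
  those of the fibre by \<open>Inr\<close>) and the metric \<open>h + f\<^sup>2 g\<close>.\<close>

definition warped_product ::
    "('p, 'c, 'n::finite) semi_riem \<Rightarrow> ('p \<Rightarrow> real) \<Rightarrow> ('q, 'e, 'm::finite) semi_riem \<Rightarrow>
     ('p \<times> 'q, 'c \<times> 'e, 'n + 'm) semi_riem" where
  "warped_product B f N =
     \<lparr>topo = prod_topology (topo B) (topo N),
      charts = charts B \<times> charts N,
      chart_dom = (\<lambda>(c, e). chart_dom B c \<times> chart_dom N e),
      coord = (\<lambda>(c, e) (p, q). \<chi> k. case k of Inl i \<Rightarrow> coord B c p $ i | Inr a \<Rightarrow> coord N e q $ a),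
      metr = (\<lambda>(c, e) (p, q). \<chi> k l. case (k, l) of
                (Inl i, Inl j) \<Rightarrow> metr B c p $ i $ j
              | (Inr a, Inr b) \<Rightarrow> (f p)\<^sup>2 * metr N e q $ a $ b
              | _ \<Rightarrow> 0)\<rparr>"

definition lin_coord :: "real^'n::finite \<Rightarrow> real^'n \<Rightarrow> real" where
  "lin_coord \<alpha> x = (\<Sum>k\<in>UNIV. \<alpha> $ k * x $ k)"

text \<open>Invariance on \<open>M\<close> under all translations that preserve \<open>lin_coord \<alpha>\<close>.\<close>

definition depends_only_on :: "real^'n::finite \<Rightarrow> (real^'n) set \<Rightarrow> (real^'n \<Rightarrow> real) \<Rightarrow> bool" where
  "depends_only_on \<alpha> M u \<longleftrightarrow>
     (\<forall>x\<in>M. \<forall>v. (\<forall>y. lin_coord \<alpha> (y + v) = lin_coord \<alpha> y) \<longrightarrow> u (x + v) = u x)"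

end

theory Submission
  imports Defs
begin

text \<open>
  All data depend on \<open>t = \<xi>(x)\<close> only, so the Einstein condition is a system of ordinary differential
  equations for the profiles of \<open>\<psi>\<close> and \<open>f\<close>.  The Ricci tensor of a warped product has a base block
  \<open>Ric\<^sub>B - m Hess f / f\<close> and a fibre block \<open>Ric\<^sub>N - (f \<Delta>f + (m - 1) |grad f|\<^sup>2) h\<close> (\<open>ricci_base\<close>,
  \<open>ricci_fibre\<close>).  For the metric \<open>\<epsilon>/\<psi>\<^sup>2\<close> on the base, the base block is a combination of \<open>\<alpha> \<otimes> \<alpha>\<close> and \<open>\<epsilon>\<close>
  (\<open>ricci_base_plane\<close>).  These are linearly independent, so with \<open>Ric\<^sub>N = 0\<close> and \<open>L = \<kappa> \<lambda>\<close> the Einstein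
  condition amounts to

  \<open>(n - 2) \<psi>''/\<psi> = m (f''/f + 2 \<psi>' f'/(\<psi> f))\<close>,

  \<open>\<psi> \<psi>'' - (n - 1) \<psi>'\<^sup>2 + m \<psi> \<psi>' f'/f = L\<close>,

  \<open>f f'' \<psi>\<^sup>2 + (m - 1) f'\<^sup>2 \<psi>\<^sup>2 - (n - 2) f f' \<psi> \<psi>' = - L f\<^sup>2\<close>,

  and constancy of the scalar curvature to \<open>2 \<psi> \<psi>'' - n \<psi>'\<^sup>2 = c\<close> (\<open>scalar_curvature_B\<close>).

  These four equations are algebraic in \<open>\<psi>'\<close>, \<open>\<psi> \<psi>''\<close>, \<open>\<psi> f'/f\<close> and \<open>\<psi>\<^sup>2 f''/f\<close>.  Elimination leaves a
  nontrivial polynomial equation for \<open>\<psi>'\<close> with constant coefficients (\<open>slope_quartic\<close>), so \<open>\<psi>'\<close> takes finitely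
  many values and is constant by continuity.  If \<open>\<psi>\<close> were constant, the equations would force \<open>f' = 0\<close>;
  so \<open>\<psi>\<close> is affine with nonzero slope, and the remaining equations say that \<open>f \<psi>\<close> is constant
  (\<open>einstein_profile_odes\<close>).  This is the second alternative, with \<open>\<Theta> = f |\<psi>|\<close>.
\<close>

section \<open>Partial derivatives\<close>

text \<open>The Frechet derivative is a choice operator applied to the derivative relation, and that
  relation is local; so locality holds even where a function is not differentiable.  This lets
  metrics, Christoffel symbols and curvatures be replaced by formulas valid near a point.\<close>

lemma partial_deriv_cong:
  assumes "open S" "x \<in> S" "\<And>y. y \<in> S \<Longrightarrow> u y = v y"
  shows "partial_deriv i u x = partial_deriv i v x"
proof -
  have "(u has_derivative D) (at x) \<longleftrightarrow> (v has_derivative D) (at x)" for D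
    using has_derivative_transform_within_open[of u D x UNIV S v]
      has_derivative_transform_within_open[of v D x UNIV S u] assms by auto
  then show ?thesis
    by (simp add: partial_deriv_def frechet_derivative_def)
qed

lemma differentiable_cong_open:
  assumes "u differentiable (at x)" "open S" "x \<in> S" "\<And>y. y \<in> S \<Longrightarrow> u y = v y"
  shows "v differentiable (at x)"
  using assms has_derivative_transform_within_open[of u _ x UNIV S v]
  unfolding differentiable_def by blast

lemma partial_deriv_eqI:
  "(u has_derivative D) (at x) \<Longrightarrow> partial_deriv i u x = D (axis i 1)"
  by (metis frechet_derivative_at partial_deriv_def)

lemma has_derivative_frechet:
  "u differentiable (at x) \<Longrightarrow> (u has_derivative frechet_derivative u (at x)) (at x)"
  by (simp add: frechet_derivative_works)

lemma partial_deriv_const [simp]: "partial_deriv i (\<lambda>y. c) x = 0"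
  by (simp add: partial_deriv_def frechet_derivative_const)

lemma partial_deriv_mult:
  assumes "u differentiable (at x)" "v differentiable (at x)"
  shows "partial_deriv i (\<lambda>y. u y * v y) x = u x * partial_deriv i v x + partial_deriv i u x * v x"
  using partial_deriv_eqI[OF has_derivative_mult[OF assms[THEN has_derivative_frechet]]]
  by (simp add: partial_deriv_def)

lemma partial_deriv_minus:
  assumes "u differentiable (at x)"
  shows "partial_deriv i (\<lambda>y. - u y) x = - partial_deriv i u x"
  using partial_deriv_eqI[OF has_derivative_minus[OF has_derivative_frechet[OF assms]]]
  by (simp add: partial_deriv_def)

lemma partial_deriv_power2:
  assumes "u differentiable (at x)"
  shows "partial_deriv i (\<lambda>y. (u y)\<^sup>2) x = 2 * u x * partial_deriv i u x"
  using partial_deriv_mult[OF assms assms] by (simp add: power2_eq_square)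

lemma partial_deriv_linear_compose:
  assumes "bounded_linear L" "u differentiable (at (L x))"
  shows "partial_deriv i (\<lambda>y. u (L y)) x = frechet_derivative u (at (L x)) (L (axis i 1))"
  using partial_deriv_eqI[OF has_derivative_compose[OF bounded_linear_imp_has_derivative[OF assms(1)]
        has_derivative_frechet[OF assms(2)]]] by simp

lemma differentiable_linear_compose:
  assumes "bounded_linear L" "u differentiable (at (L x))"
  shows "(\<lambda>y. u (L y)) differentiable (at x)"
  using differentiable_compose[OF _ bounded_linear_imp_differentiable[OF assms(1)]] assms(2) by blast

definition twice_differentiable_on :: "(real^'d::finite) set \<Rightarrow> (real^'d \<Rightarrow> real) \<Rightarrow> bool" where
  "twice_differentiable_on S u \<longleftrightarrow>
     (\<forall>x\<in>S. u differentiable (at x) \<and> (\<forall>i. partial_deriv i u differentiable (at x)))"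

lemma smooth_on_imp_twice_differentiable_on:
  assumes "smooth_on S u" shows "twice_differentiable_on S u"
proof -
  have "Ck_on (Suc (Suc 0)) S u" using assms by (simp only: smooth_on_def)
  then show ?thesis by (simp add: twice_differentiable_on_def)
qed

lemma christoffel_cong:
  assumes "open S" "x \<in> S" "\<And>y. y \<in> S \<Longrightarrow> G y = G' y"
  shows "christoffel G k i j x = christoffel G' k i j x"
proof -
  have "partial_deriv a (\<lambda>y. G y $ b $ c) x = partial_deriv a (\<lambda>y. G' y $ b $ c) x" for a b c
    by (rule partial_deriv_cong[OF assms(1,2)]) (simp add: assms(3))
  then show ?thesis by (simp add: christoffel_def assms)
qed

lemma ricci_coords_cong:
  assumes "open S" "x \<in> S" "\<And>y. y \<in> S \<Longrightarrow> G y = G' y"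
  shows "ricci_coords G x = ricci_coords G' x"
proof -
  have c: "christoffel G k i j y = christoffel G' k i j y" if "y \<in> S" for k i j y
    by (rule christoffel_cong[OF assms(1) that]) (simp add: assms(3))
  have "partial_deriv a (christoffel G k i j) x = partial_deriv a (christoffel G' k i j) x" for a k i j
    by (rule partial_deriv_cong[OF assms(1,2)]) (simp add: c)
  then show ?thesis by (simp add: ricci_coords_def riemann_def c assms)
qed

section \<open>Inverse matrices\<close>

lemma matrix_inv_eqI:
  fixes A :: "real^'n^'n"
  assumes "A ** B = mat 1" "B ** A = mat 1"
  shows "matrix_inv A = B"
proof -
  have "\<exists>A'. A ** A' = mat 1 \<and> A' ** A = mat 1" using assms by blast
  then have *: "A ** matrix_inv A = mat 1 \<and> matrix_inv A ** A = mat 1"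
    unfolding matrix_inv_def by (rule someI_ex)
  have "matrix_inv A = matrix_inv A ** (A ** B)" by (simp add: assms)
  also have "\<dots> = B" using * by (simp add: matrix_mul_assoc)
  finally show ?thesis .
qed

lemma matrix_inv_inverse:
  fixes A :: "real^'n^'n"
  assumes "invertible A"
  shows "A ** matrix_inv A = mat 1" "matrix_inv A ** A = mat 1"
  using assms matrix_inv_eqI unfolding invertible_def by metis+

lemma matrix_inv_scaleR:
  fixes A :: "real^'n^'n"
  assumes "invertible A" "c \<noteq> 0"
  shows "invertible (c *\<^sub>R A)" "matrix_inv (c *\<^sub>R A) = (1/c) *\<^sub>R matrix_inv A"
proof -
  have "c *\<^sub>R A ** (1/c) *\<^sub>R matrix_inv A = mat 1" "(1/c) *\<^sub>R matrix_inv A ** c *\<^sub>R A = mat 1"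
    using matrix_inv_inverse[OF assms(1)] assms(2)
    by (simp_all add: vec_eq_iff matrix_matrix_mult_def)
  then show "invertible (c *\<^sub>R A)" "matrix_inv (c *\<^sub>R A) = (1/c) *\<^sub>R matrix_inv A"
    by (auto simp: invertible_def intro: matrix_inv_eqI)
qed

lemma differentiable_det:
  fixes A :: "'a::real_normed_vector \<Rightarrow> real^'n^'n"
  assumes "\<And>i j. (\<lambda>y. A y $ i $ j) differentiable (at x)"
  shows "(\<lambda>y. det (A y)) differentiable (at x)"
proof -
  have "(\<lambda>y. \<Prod>i\<in>UNIV. A y $ i $ p i) differentiable (at x)" for p :: "'n \<Rightarrow> 'n"
    by (rule differentiableI, rule has_derivative_prod, rule has_derivative_frechet) (rule assms)
  then have "(\<lambda>y. of_int (sign p) * (\<Prod>i\<in>UNIV. A y $ i $ p i)) differentiable (at x)" for p :: "'n \<Rightarrow> 'n"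
    by (rule differentiable_mult[OF differentiable_const])
  then show ?thesis unfolding det_def
    by (intro differentiable_sum ballI) (simp_all add: finite_permutations)
qed

text \<open>By Cramer's rule the entries of the inverse are rational functions of the entries.\<close>

lemma differentiable_matrix_inv:
  fixes A :: "'a::real_normed_vector \<Rightarrow> real^'n^'n"
  assumes "\<And>i j. (\<lambda>y. A y $ i $ j) differentiable (at x)" "open S" "x \<in> S"
    and inv: "\<And>y. y \<in> S \<Longrightarrow> invertible (A y)"
  shows "(\<lambda>y. matrix_inv (A y) $ k $ l) differentiable (at x)"
proof -
  let ?C = "\<lambda>y. (\<chi> i j. if j = k then axis l 1 $ i else A y $ i $ j) :: real^'n^'n"
  have d: "(\<lambda>y. det (?C y)) differentiable (at x)"
  proof (rule differentiable_det)
    show "(\<lambda>y. ?C y $ i $ j) differentiable (at x)" for i j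
      by (cases "j = k") (simp_all add: assms)
  qed
  have nz: "det (A y) \<noteq> 0" if "y \<in> S" for y
    using inv[OF that] by (simp add: invertible_det_nz)
  have "det (?C y) / det (A y) = matrix_inv (A y) $ k $ l" if "y \<in> S" for y
  proof -
    have "A y *v (matrix_inv (A y) *v axis l 1) = axis l 1"
      using matrix_inv_inverse[OF inv[OF that]] by (simp add: matrix_vector_mul_assoc)
    then have "(matrix_inv (A y) *v axis l 1) $ k = det (?C y) / det (A y)"
      using cramer[OF nz[OF that]] by simp
    then show ?thesis by (simp add: matrix_vector_mult_basis column_def)
  qed
  with differentiable_divide[OF d differentiable_det[OF assms(1)] nz[OF assms(3)]] show ?thesis
    by (rule differentiable_cong_open[OF _ assms(2,3)])
qed

text \<open>Outside the points of differentiability \<^const>\<open>partial_deriv\<close> has arbitrary values, so the chain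
  rules of the next section can be applied to Christoffel symbols only after this has been checked.\<close>

lemma christoffel_differentiable:
  assumes S: "open S" "x \<in> S" and G: "\<And>i j. twice_differentiable_on S (\<lambda>y. G y $ i $ j)"
    and inv: "\<And>y. y \<in> S \<Longrightarrow> invertible (G y)"
  shows "christoffel G k i j differentiable (at x)"
proof -
  have "(\<lambda>y. matrix_inv (G y) $ k $ l) differentiable (at x)" for l
    by (rule differentiable_matrix_inv[OF _ S inv]) (use G S in \<open>auto simp: twice_differentiable_on_def\<close>)
  moreover have "partial_deriv a (\<lambda>y. G y $ b $ c) differentiable (at x)" for a b c
    using G S by (auto simp: twice_differentiable_on_def)
  ultimately have t: "(\<lambda>y. matrix_inv (G y) $ k $ l *
        (partial_deriv i (\<lambda>y. G y $ j $ l) y + partial_deriv j (\<lambda>y. G y $ i $ l) y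
         - partial_deriv l (\<lambda>y. G y $ i $ j) y)) differentiable (at x)" for l
    by (intro differentiable_mult differentiable_add differentiable_diff)
  have "(\<lambda>y. \<Sum>l\<in>UNIV. matrix_inv (G y) $ k $ l *
        (partial_deriv i (\<lambda>y. G y $ j $ l) y + partial_deriv j (\<lambda>y. G y $ i $ l) y
         - partial_deriv l (\<lambda>y. G y $ i $ j) y)) differentiable (at x)"
    by (rule differentiable_sum) (use t in auto)
  then have "(\<lambda>y. 1/2 * (\<Sum>l\<in>UNIV. matrix_inv (G y) $ k $ l *
        (partial_deriv i (\<lambda>y. G y $ j $ l) y + partial_deriv j (\<lambda>y. G y $ i $ l) y
         - partial_deriv l (\<lambda>y. G y $ i $ j) y))) differentiable (at x)"
    by (rule differentiable_mult[OF differentiable_const])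
  moreover have "christoffel G k i j = (\<lambda>y. 1/2 * (\<Sum>l\<in>UNIV. matrix_inv (G y) $ k $ l *
        (partial_deriv i (\<lambda>y. G y $ j $ l) y + partial_deriv j (\<lambda>y. G y $ i $ l) y
         - partial_deriv l (\<lambda>y. G y $ i $ j) y)))"
    by (rule ext) (rule christoffel_def)
  ultimately show ?thesis by (simp only:)
qed

section \<open>Ricci curvature of a warped product in coordinates\<close>

definition base_part :: "real^('n::finite + 'm::finite) \<Rightarrow> real^'n" where
  "base_part y = (\<chi> i. y $ Inl i)"

definition fibre_part :: "real^('n::finite + 'm::finite) \<Rightarrow> real^'m" where
  "fibre_part y = (\<chi> a. y $ Inr a)"

definition block_diag ::
    "real^'n^'n \<Rightarrow> real^'m^'m \<Rightarrow> real^('n::finite + 'm::finite)^('n + 'm)" where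
  "block_diag A D = (\<chi> k l. case (k, l) of
      (Inl i, Inl j) \<Rightarrow> A $ i $ j | (Inr a, Inr b) \<Rightarrow> D $ a $ b | _ \<Rightarrow> 0)"

definition warped_metric ::
    "(real^'n::finite \<Rightarrow> real^'n^'n) \<Rightarrow> (real^'n \<Rightarrow> real) \<Rightarrow> (real^'m::finite \<Rightarrow> real^'m^'m) \<Rightarrow>
     real^('n + 'm) \<Rightarrow> real^('n + 'm)^('n + 'm)" where
  "warped_metric B f h y = block_diag (B (base_part y)) ((f (base_part y))\<^sup>2 *\<^sub>R h (fibre_part y))"

lemma block_diag_nth [simp]:
  "block_diag A D $ Inl i $ Inl j = A $ i $ j"
  "block_diag A D $ Inr a $ Inr b = D $ a $ b"
  "block_diag A D $ Inl i $ Inr b = 0"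
  "block_diag A D $ Inr a $ Inl j = 0"
  by (simp_all add: block_diag_def)

lemma sum_UNIV_sum:
  fixes g :: "'n::finite + 'm::finite \<Rightarrow> 'a::comm_monoid_add"
  shows "(\<Sum>k\<in>UNIV. g k) = (\<Sum>i\<in>UNIV. g (Inl i)) + (\<Sum>a\<in>UNIV. g (Inr a))"
  using sum.Plus[of "UNIV :: 'n set" "UNIV :: 'm set" g] by (simp add: comp_def)

lemma block_diag_mult:
  "block_diag A D ** block_diag A' D' = block_diag (A ** A') (D ** D')"
  by (simp add: vec_eq_iff split_sum_all matrix_matrix_mult_def sum_UNIV_sum)

lemma block_diag_mat_1: "block_diag (mat 1) (mat 1) = mat 1"
  by (simp add: vec_eq_iff split_sum_all mat_def)

lemma matrix_inv_block_diag:
  assumes "invertible A" "invertible D"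
  shows "matrix_inv (block_diag A D) = block_diag (matrix_inv A) (matrix_inv D)"
  by (rule matrix_inv_eqI) (simp_all add: block_diag_mult matrix_inv_inverse assms block_diag_mat_1)

lemma bounded_linear_base_part: "bounded_linear base_part"
  by (rule linear_conv_bounded_linear[THEN iffD1], rule linearI) (simp_all add: base_part_def vec_eq_iff)

lemma bounded_linear_fibre_part: "bounded_linear fibre_part"
  by (rule linear_conv_bounded_linear[THEN iffD1], rule linearI) (simp_all add: fibre_part_def vec_eq_iff)

lemma open_parts:
  assumes "open U" "open V"
  shows "open {y :: real^('n::finite + 'm::finite). base_part y \<in> U \<and> fibre_part y \<in> V}"
proof -
  have "open (base_part -` U \<inter> fibre_part -` V :: (real^('n + 'm)) set)"
    using assms by (intro open_Int continuous_open_vimage linear_continuous_at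
        bounded_linear_base_part bounded_linear_fibre_part) auto
  then show ?thesis by (simp add: vimage_def Int_def)
qed

lemma part_axis:
  "base_part (axis (Inl i) 1) = axis i 1" "base_part (axis (Inr a) 1) = 0"
  "fibre_part (axis (Inl i) 1) = 0" "fibre_part (axis (Inr a) 1) = axis a 1"
  by (simp_all add: base_part_def fibre_part_def vec_eq_iff axis_def)

lemma frechet_derivative_zero: "u differentiable (at x) \<Longrightarrow> frechet_derivative u (at x) 0 = 0"
  by (simp add: linear_0 linear_frechet_derivative)

lemma partial_deriv_base:
  assumes "u differentiable (at (base_part y))"
  shows "(\<lambda>y. u (base_part y)) differentiable (at y)"
    "partial_deriv (Inl i) (\<lambda>y. u (base_part y)) y = partial_deriv i u (base_part y)"
    "partial_deriv (Inr a) (\<lambda>y. u (base_part y)) y = 0"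
  using assms by (simp_all add: differentiable_linear_compose[OF bounded_linear_base_part]
      partial_deriv_linear_compose[OF bounded_linear_base_part] part_axis frechet_derivative_zero)
    (simp_all add: partial_deriv_def)

lemma partial_deriv_fibre:
  assumes "u differentiable (at (fibre_part y))"
  shows "(\<lambda>y. u (fibre_part y)) differentiable (at y)"
    "partial_deriv (Inl i) (\<lambda>y. u (fibre_part y)) y = 0"
    "partial_deriv (Inr a) (\<lambda>y. u (fibre_part y)) y = partial_deriv a u (fibre_part y)"
  using assms by (simp_all add: differentiable_linear_compose[OF bounded_linear_fibre_part]
      partial_deriv_linear_compose[OF bounded_linear_fibre_part] part_axis frechet_derivative_zero)
    (simp_all add: partial_deriv_def)

lemma partial_deriv_base_times_fibre:
  assumes "u differentiable (at (base_part y))" "v differentiable (at (fibre_part y))"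
  shows "partial_deriv (Inl i) (\<lambda>y. u (base_part y) * v (fibre_part y)) y =
      partial_deriv i u (base_part y) * v (fibre_part y)"
    "partial_deriv (Inr a) (\<lambda>y. u (base_part y) * v (fibre_part y)) y =
      u (base_part y) * partial_deriv a v (fibre_part y)"
  using assms by (simp_all add: partial_deriv_mult partial_deriv_base partial_deriv_fibre)

locale warped_coordinates =
  fixes B :: "real^'n::finite \<Rightarrow> real^'n^'n" and f :: "real^'n \<Rightarrow> real"
    and h :: "real^'m::finite \<Rightarrow> real^'m^'m" and U :: "(real^'n) set" and V :: "(real^'m) set"
  assumes U: "open U" and V: "open V"
    and B: "\<And>i j. twice_differentiable_on U (\<lambda>x. B x $ i $ j)" "\<And>x. x \<in> U \<Longrightarrow> invertible (B x)"
    and f: "twice_differentiable_on U f" "\<And>x. x \<in> U \<Longrightarrow> f x \<noteq> 0"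
    and h: "\<And>a b. twice_differentiable_on V (\<lambda>v. h v $ a $ b)" "\<And>v. v \<in> V \<Longrightarrow> invertible (h v)"
      "\<And>v. v \<in> V \<Longrightarrow> transpose (h v) = h v"
begin

text \<open>\<open>log_grad i\<close> is \<open>\<partial>\<^sub>i (ln \<bar>f\<bar>)\<close>, and \<open>warp_grad k\<close> is the \<open>k\<close>-component of the gradient
  of \<open>f\<^sup>2/2\<close>; the Christoffel symbols which mix base and fibre are expressed by them.\<close>

definition log_grad :: "'n \<Rightarrow> real^'n \<Rightarrow> real" where
  "log_grad i x = partial_deriv i f x / f x"

definition warp_grad :: "'n \<Rightarrow> real^'n \<Rightarrow> real" where
  "warp_grad k x = f x * (\<Sum>l\<in>UNIV. matrix_inv (B x) $ k $ l * partial_deriv l f x)"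

abbreviation G where "G \<equiv> warped_metric B f h"

definition W :: "(real^('n + 'm)) set" where
  "W = {y. base_part y \<in> U \<and> fibre_part y \<in> V}"

lemma open_W: "open W"
  unfolding W_def by (rule open_parts[OF U V])

lemma W_parts: "y \<in> W \<Longrightarrow> base_part y \<in> U" "y \<in> W \<Longrightarrow> fibre_part y \<in> V"
  by (simp_all add: W_def)

lemma diff_B: "x \<in> U \<Longrightarrow> (\<lambda>x. B x $ i $ j) differentiable (at x)"
  and diff_f: "x \<in> U \<Longrightarrow> f differentiable (at x)"
  and diff_df: "x \<in> U \<Longrightarrow> partial_deriv i f differentiable (at x)"
  and diff_h: "v \<in> V \<Longrightarrow> (\<lambda>v. h v $ a $ b) differentiable (at v)"
  using B f h by (simp_all add: twice_differentiable_on_def)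

lemma h_sym: "v \<in> V \<Longrightarrow> h v $ a $ b = h v $ b $ a"
  using arg_cong[where f = "\<lambda>A. A $ b $ a", OF h(3)] by (simp add: transpose_def)

lemma diff_log_grad: "x \<in> U \<Longrightarrow> log_grad i differentiable (at x)"
  unfolding log_grad_def[abs_def] by (rule differentiable_divide) (use diff_df diff_f f in auto)

lemma diff_warp_grad:
  assumes "x \<in> U" shows "warp_grad k differentiable (at x)"
proof -
  have "(\<lambda>x. matrix_inv (B x) $ k $ l) differentiable (at x)" for l
    by (rule differentiable_matrix_inv[OF diff_B U assms]) (use assms B in auto)
  then have "(\<lambda>x. matrix_inv (B x) $ k $ l * partial_deriv l f x) differentiable (at x)" for l
    using diff_df[OF assms] by (rule differentiable_mult)
  then have "(\<lambda>x. \<Sum>l\<in>UNIV. matrix_inv (B x) $ k $ l * partial_deriv l f x) differentiable (at x)"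
    by (intro differentiable_sum) auto
  with diff_f[OF assms] show ?thesis
    unfolding warp_grad_def[abs_def] by (rule differentiable_mult)
qed

lemma matrix_inv_G:
  assumes "y \<in> W"
  shows "matrix_inv (G y) = block_diag (matrix_inv (B (base_part y)))
    ((1 / (f (base_part y))\<^sup>2) *\<^sub>R matrix_inv (h (fibre_part y)))"
  unfolding warped_metric_def
  using W_parts[OF assms] by (simp add: matrix_inv_block_diag matrix_inv_scaleR B f h)

lemma partial_deriv_G:
  assumes y: "y \<in> W"
  shows "partial_deriv (Inl l) (\<lambda>y. G y $ Inl i $ Inl j) y = partial_deriv l (\<lambda>x. B x $ i $ j) (base_part y)"
    "partial_deriv (Inr c) (\<lambda>y. G y $ Inl i $ Inl j) y = 0"
    "partial_deriv k (\<lambda>y. G y $ Inl i $ Inr b) y = 0"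
    "partial_deriv k (\<lambda>y. G y $ Inr a $ Inl j) y = 0"
    "partial_deriv (Inl l) (\<lambda>y. G y $ Inr a $ Inr b) y =
       2 * f (base_part y) * partial_deriv l f (base_part y) * h (fibre_part y) $ a $ b"
    "partial_deriv (Inr c) (\<lambda>y. G y $ Inr a $ Inr b) y =
       (f (base_part y))\<^sup>2 * partial_deriv c (\<lambda>v. h v $ a $ b) (fibre_part y)"
proof -
  note d = diff_B[OF W_parts(1)[OF y]] diff_f[OF W_parts(1)[OF y]] diff_h[OF W_parts(2)[OF y]]
  have d2: "(\<lambda>x. (f x)\<^sup>2) differentiable (at (base_part y))"
    by (rule differentiable_power) (rule d)
  show "partial_deriv (Inl l) (\<lambda>y. G y $ Inl i $ Inl j) y = partial_deriv l (\<lambda>x. B x $ i $ j) (base_part y)"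
    "partial_deriv (Inr c) (\<lambda>y. G y $ Inl i $ Inl j) y = 0"
    using partial_deriv_base[OF d(1)] by (simp_all add: warped_metric_def)
  show "partial_deriv k (\<lambda>y. G y $ Inl i $ Inr b) y = 0"
    "partial_deriv k (\<lambda>y. G y $ Inr a $ Inl j) y = 0"
    by (simp_all add: warped_metric_def)
  show "partial_deriv (Inl l) (\<lambda>y. G y $ Inr a $ Inr b) y =
       2 * f (base_part y) * partial_deriv l f (base_part y) * h (fibre_part y) $ a $ b"
    "partial_deriv (Inr c) (\<lambda>y. G y $ Inr a $ Inr b) y =
       (f (base_part y))\<^sup>2 * partial_deriv c (\<lambda>v. h v $ a $ b) (fibre_part y)"
    using partial_deriv_base_times_fibre[OF d2 d(3), of _ a b] 
    by (simp_all add: warped_metric_def partial_deriv_power2[OF d(2)])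
qed

text \<open>The transposed index in \<open>h\<close> is the one that occurs in the Christoffel symbols; symmetry of the
  fibre metric turns the sum into a matrix product.\<close>

lemma inv_h_mult:
  assumes "v \<in> V"
  shows "(\<Sum>d\<in>UNIV. matrix_inv (h v) $ c $ d * h v $ b $ d) = (if c = b then 1 else 0)"
proof -
  have "(matrix_inv (h v) ** h v) $ c $ b = (mat 1 :: real^'m^'m) $ c $ b"
    using matrix_inv_inverse(2)[OF h(2)[OF assms]] by simp
  then show ?thesis
    by (simp add: matrix_matrix_mult_def mat_def h_sym[OF assms, of b])
qed

lemma christoffel_G:
  assumes y: "y \<in> W"
  shows "christoffel G (Inl k) (Inl i) (Inl j) y = christoffel B k i j (base_part y)"
    "christoffel G (Inl k) (Inl i) (Inr b) y = 0"
    "christoffel G (Inl k) (Inr b) (Inl i) y = 0"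
    "christoffel G (Inl k) (Inr a) (Inr b) y = - (warp_grad k (base_part y) * h (fibre_part y) $ a $ b)"
    "christoffel G (Inr c) (Inl i) (Inl j) y = 0"
    "christoffel G (Inr c) (Inl i) (Inr b) y = (if c = b then log_grad i (base_part y) else 0)"
    "christoffel G (Inr c) (Inr b) (Inl i) y = (if c = b then log_grad i (base_part y) else 0)"
    "christoffel G (Inr c) (Inr a) (Inr b) y = christoffel h c a b (fibre_part y)"
proof -
  have f0: "f (base_part y) \<noteq> 0" using f W_parts y by blast
  note s = christoffel_def sum_UNIV_sum matrix_inv_G[OF y] partial_deriv_G[OF y]
  show "christoffel G (Inl k) (Inl i) (Inl j) y = christoffel B k i j (base_part y)"
    "christoffel G (Inl k) (Inl i) (Inr b) y = 0"
    "christoffel G (Inl k) (Inr b) (Inl i) y = 0"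
    "christoffel G (Inr c) (Inl i) (Inl j) y = 0"
    by (simp_all add: s)
  show "christoffel G (Inl k) (Inr a) (Inr b) y = - (warp_grad k (base_part y) * h (fibre_part y) $ a $ b)"
    by (simp add: s warp_grad_def sum_distrib_left sum_distrib_right sum_negf algebra_simps)
  have "(\<Sum>d\<in>UNIV. matrix_inv (h (fibre_part y)) $ c $ d *
          (2 * f (base_part y) * partial_deriv i f (base_part y) * h (fibre_part y) $ b $ d) / (f (base_part y))\<^sup>2) =
      2 * log_grad i (base_part y) *
        (\<Sum>d\<in>UNIV. matrix_inv (h (fibre_part y)) $ c $ d * h (fibre_part y) $ b $ d)"
    using f0 by (simp add: log_grad_def sum_distrib_left power2_eq_square field_simps)
  then show "christoffel G (Inr c) (Inl i) (Inr b) y = (if c = b then log_grad i (base_part y) else 0)"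
    "christoffel G (Inr c) (Inr b) (Inl i) y = (if c = b then log_grad i (base_part y) else 0)"
    using inv_h_mult[OF W_parts(2)[OF y], of c b] by (simp_all add: s)
  show "christoffel G (Inr c) (Inr a) (Inr b) y = christoffel h c a b (fibre_part y)"
    using f0 by (simp add: s sum_distrib_left field_simps)
qed

lemma partial_deriv_christoffel_G:
  assumes y: "y \<in> W"
  shows "partial_deriv (Inl l) (christoffel G (Inl k) (Inl i) (Inl j)) y
      = partial_deriv l (christoffel B k i j) (base_part y)"
    "partial_deriv p (christoffel G (Inl k) (Inl i) (Inr b)) y = 0"
    "partial_deriv p (christoffel G (Inl k) (Inr b) (Inl i)) y = 0"
    "partial_deriv (Inl l) (christoffel G (Inl k) (Inr a) (Inr b)) y
      = - (partial_deriv l (warp_grad k) (base_part y) * h (fibre_part y) $ a $ b)"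
    "partial_deriv p (christoffel G (Inr c) (Inl i) (Inl j)) y = 0"
    "partial_deriv (Inl l) (christoffel G (Inr c) (Inl i) (Inr b)) y
      = (if c = b then partial_deriv l (log_grad i) (base_part y) else 0)"
    "partial_deriv (Inr d) (christoffel G (Inr c) (Inr b) (Inl i)) y = 0"
    "partial_deriv (Inr d) (christoffel G (Inr c) (Inr a) (Inr b)) y
      = partial_deriv d (christoffel h c a b) (fibre_part y)"
proof -
  note cong = partial_deriv_cong[OF open_W y]
  note x = W_parts(1)[OF y] and v = W_parts(2)[OF y]
  show "partial_deriv (Inl l) (christoffel G (Inl k) (Inl i) (Inl j)) y
      = partial_deriv l (christoffel B k i j) (base_part y)"
    using cong[OF christoffel_G(1)]
      partial_deriv_base(2)[OF christoffel_differentiable[OF U x B]] by simp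
  show "partial_deriv p (christoffel G (Inl k) (Inl i) (Inr b)) y = 0"
    using cong[OF christoffel_G(2)] by simp
  show "partial_deriv p (christoffel G (Inl k) (Inr b) (Inl i)) y = 0"
    using cong[OF christoffel_G(3)] by simp
  show "partial_deriv p (christoffel G (Inr c) (Inl i) (Inl j)) y = 0"
    using cong[OF christoffel_G(5)] by simp
  show "partial_deriv (Inr d) (christoffel G (Inr c) (Inr a) (Inr b)) y
      = partial_deriv d (christoffel h c a b) (fibre_part y)"
    using cong[OF christoffel_G(8)]
      partial_deriv_fibre(3)[OF christoffel_differentiable[OF V v h(1,2)]] by simp
  show "partial_deriv (Inl l) (christoffel G (Inr c) (Inl i) (Inr b)) y
      = (if c = b then partial_deriv l (log_grad i) (base_part y) else 0)"
    using cong[OF christoffel_G(6)] partial_deriv_base(2)[OF diff_log_grad[OF x]]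
    by (cases "c = b") simp_all
  show "partial_deriv (Inr d) (christoffel G (Inr c) (Inr b) (Inl i)) y = 0"
    using cong[OF christoffel_G(7)] partial_deriv_base(3)[OF diff_log_grad[OF x]]
    by (cases "c = b") simp_all
  have m: "(\<lambda>y. warp_grad k (base_part y) * h (fibre_part y) $ a $ b) differentiable (at y)"
    by (intro differentiable_mult partial_deriv_base(1)[OF diff_warp_grad[OF x]]
        partial_deriv_fibre(1)[OF diff_h[OF v]])
  show "partial_deriv (Inl l) (christoffel G (Inl k) (Inr a) (Inr b)) y
      = - (partial_deriv l (warp_grad k) (base_part y) * h (fibre_part y) $ a $ b)"
    using cong[OF christoffel_G(4)] partial_deriv_minus[OF m]
      partial_deriv_base_times_fibre(1)[OF diff_warp_grad[OF x] diff_h[OF v]] by simp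
qed

text \<open>O'Neill's formula \<open>Ric(i,j) = Ric\<^sub>B(i,j) - m Hess f(i,j) / f\<close>.  Each of the \<open>m\<close> fibre directions
  contributes the same term to the trace, and this term is the Hessian of \<open>f\<close> divided by \<open>f\<close>,
  written here with the derivatives of \<open>ln \<bar>f\<bar>\<close>.\<close>

lemma ricci_base:
  assumes y: "y \<in> W"
  shows "ricci_coords G y $ Inl i $ Inl j = ricci_coords B (base_part y) $ i $ j
    - real CARD('m) * (partial_deriv j (log_grad i) (base_part y)
        + log_grad i (base_part y) * log_grad j (base_part y)
        - (\<Sum>p\<in>UNIV. log_grad p (base_part y) * christoffel B p i j (base_part y)))"
proof -
  let ?x = "base_part y"
  have 1: "riemann G (Inl l) (Inl i) (Inl l) (Inl j) y = riemann B l i l j ?x" for l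
    by (simp add: riemann_def sum_UNIV_sum christoffel_G[OF y] partial_deriv_christoffel_G[OF y])
  have 2: "riemann G (Inr c) (Inl i) (Inr c) (Inl j) y = - (partial_deriv j (log_grad i) ?x
        + log_grad i ?x * log_grad j ?x - (\<Sum>p\<in>UNIV. log_grad p ?x * christoffel B p i j ?x))" for c
    by (simp add: riemann_def sum_UNIV_sum christoffel_G[OF y] partial_deriv_christoffel_G[OF y] sum_subtractf
        if_distrib[where f = "\<lambda>t. t * _"] if_distrib[where f = "\<lambda>t. _ * t"] sum.delta cong: if_cong)
  show ?thesis by (simp add: ricci_coords_def sum_UNIV_sum 1 2 algebra_simps)
qed

text \<open>The factor of \<open>h\<close> is \<open>div w + (m - 2) |grad f|\<^sup>2\<close> for the gradient \<open>w\<close> of \<open>f\<^sup>2/2\<close>, that is,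
  \<open>f \<Delta>f + (m - 1) |grad f|\<^sup>2\<close>.  Keeping the divergence of \<open>w\<close> avoids second derivatives of \<open>f\<close>
  against the inverse of \<open>B\<close>.\<close>

lemma ricci_fibre:
  assumes y: "y \<in> W"
  shows "ricci_coords G y $ Inr a $ Inr b = ricci_coords h (fibre_part y) $ a $ b
    - h (fibre_part y) $ a $ b * ((\<Sum>l\<in>UNIV. partial_deriv l (warp_grad l) (base_part y)
        + (\<Sum>p\<in>UNIV. christoffel B l l p (base_part y) * warp_grad p (base_part y)))
      + (real CARD('m) - 2) * (\<Sum>l\<in>UNIV. log_grad l (base_part y) * warp_grad l (base_part y)))"
proof -
  let ?x = "base_part y" and ?v = "fibre_part y"
  let ?g = "\<Sum>l\<in>UNIV. log_grad l ?x * warp_grad l ?x"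
  note if_simps = if_distrib[where f = "\<lambda>t. t * _"] if_distrib[where f = "\<lambda>t. _ * t"] sum.delta
  have 1: "riemann G (Inl l) (Inr a) (Inl l) (Inr b) y = - h ?v $ a $ b * (partial_deriv l (warp_grad l) ?x
      + (\<Sum>p\<in>UNIV. christoffel B l l p ?x * warp_grad p ?x) - log_grad l ?x * warp_grad l ?x)" for l
    by (simp add: riemann_def sum_UNIV_sum christoffel_G[OF y] partial_deriv_christoffel_G[OF y] sum_subtractf
        sum_negf if_simps h_sym[OF W_parts(2)[OF y], of b] sum_distrib_left sum_distrib_right algebra_simps cong: if_cong)
  have 2: "riemann G (Inr c) (Inr a) (Inr c) (Inr b) y = riemann h c a c b ?v - h ?v $ a $ b * ?g
      + (if c = b then h ?v $ a $ b * ?g else 0)" for c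
    by (simp add: riemann_def sum_UNIV_sum christoffel_G[OF y] partial_deriv_christoffel_G[OF y] sum_subtractf
        sum_negf if_simps sum_distrib_left sum_distrib_right algebra_simps cong: if_cong)
  show ?thesis
    by (simp add: ricci_coords_def sum_UNIV_sum 1 2 sum.distrib sum_subtractf sum_negf
       sum_distrib_left sum_distrib_right algebra_simps)
qed

end

section \<open>Functions of one linear coordinate\<close>

lemma lin_coord_inner: "lin_coord \<alpha> x = \<alpha> \<bullet> x"
  by (simp add: lin_coord_def inner_vec_def)

lemma open_slab: "open I \<Longrightarrow> open {x. lin_coord \<alpha> x \<in> I}"
  using continuous_open_vimage[of I "\<lambda>x. \<alpha> \<bullet> x"] by (simp add: lin_coord_inner vimage_def)

lemma has_derivative_plane:
  assumes "(\<phi> has_real_derivative d) (at (lin_coord \<alpha> x))"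
  shows "((\<lambda>x. \<phi> (lin_coord \<alpha> x)) has_derivative (\<lambda>v. d * lin_coord \<alpha> v)) (at x)"
  unfolding lin_coord_inner
  by (rule has_derivative_compose[of "\<lambda>x. \<alpha> \<bullet> x"])
    (use assms in \<open>auto simp: has_field_derivative_def lin_coord_inner intro!: derivative_eq_intros\<close>)

text \<open>Agreement of \<open>u\<close> with \<open>\<phi> \<circ> lin_coord \<alpha>\<close> is asked only near \<open>x\<close>, because the formulas for
  the geometric quantities hold on the slab only.\<close>

lemma plane_derivatives:
  assumes "open S" "x \<in> S" "\<And>y. y \<in> S \<Longrightarrow> u y = \<phi> (lin_coord \<alpha> y)"
    and "(\<phi> has_real_derivative d) (at (lin_coord \<alpha> x))"
  shows "u differentiable (at x)" "partial_deriv i u x = \<alpha> $ i * d"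
proof -
  have D: "(u has_derivative (\<lambda>v. d * lin_coord \<alpha> v)) (at x)"
    by (rule has_derivative_transform_within_open[OF has_derivative_plane[OF assms(4)] assms(1,2)])
      (simp add: assms(3))
  show "u differentiable (at x)" using D by (rule differentiableI)
  show "partial_deriv i u x = \<alpha> $ i * d"
    using partial_deriv_eqI[OF D] by (simp add: lin_coord_inner inner_axis)
qed

lemma twice_differentiable_on_plane:
  assumes "open I" and u: "\<And>x. lin_coord \<alpha> x \<in> I \<Longrightarrow> u x = \<phi> (lin_coord \<alpha> x)"
    and d: "\<And>t. t \<in> I \<Longrightarrow> (\<phi> has_real_derivative \<phi>' t) (at t)"
      "\<And>t. t \<in> I \<Longrightarrow> (\<phi>' has_real_derivative \<phi>'' t) (at t)"
  shows "twice_differentiable_on {x. lin_coord \<alpha> x \<in> I} u"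
proof -
  let ?M = "{x. lin_coord \<alpha> x \<in> I}"
  have 1: "u differentiable (at x)" "partial_deriv i u x = \<alpha> $ i * \<phi>' (lin_coord \<alpha> x)" if "x \<in> ?M" for x i
    using plane_derivatives[OF open_slab[OF assms(1)] that, of u \<phi> \<alpha> "\<phi>' (lin_coord \<alpha> x)"] u d that by auto
  have "partial_deriv i u differentiable (at x)" if "x \<in> ?M" for x i
    by (rule plane_derivatives(1)[OF open_slab[OF assms(1)] that, of _ "\<lambda>t. \<alpha> $ i * \<phi>' t" \<alpha> "\<alpha> $ i * \<phi>'' (lin_coord \<alpha> x)"])
      (use 1 d that in \<open>auto intro!: DERIV_cmult\<close>)
  with 1 show ?thesis by (simp add: twice_differentiable_on_def)
qed

lemma line_derivative:
  assumes "u differentiable (at (t *\<^sub>R \<beta>))"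
  shows "((\<lambda>t. u (t *\<^sub>R \<beta>)) has_real_derivative (\<Sum>i\<in>UNIV. \<beta> $ i * partial_deriv i u (t *\<^sub>R \<beta>))) (at t)"
proof -
  let ?D = "frechet_derivative u (at (t *\<^sub>R \<beta>))"
  have lin: "linear ?D" using assms by (rule linear_frechet_derivative)
  have "?D \<beta> = ?D (\<Sum>i\<in>UNIV. \<beta> $ i *\<^sub>R axis i 1)"
    using basis_expansion[of \<beta>] by (simp add: scalar_mult_eq_scaleR)
  also have "\<dots> = (\<Sum>i\<in>UNIV. \<beta> $ i * partial_deriv i u (t *\<^sub>R \<beta>))"
    by (simp add: linear_sum[OF lin] linear_scale[OF lin] partial_deriv_def)
  finally have b: "?D \<beta> = (\<Sum>i\<in>UNIV. \<beta> $ i * partial_deriv i u (t *\<^sub>R \<beta>))" .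
  have "((\<lambda>t. u (t *\<^sub>R \<beta>)) has_derivative (\<lambda>s. ?D (s *\<^sub>R \<beta>))) (at t)"
    by (rule has_derivative_compose[of "\<lambda>t. t *\<^sub>R \<beta>"])
      (auto intro!: derivative_eq_intros has_derivative_frechet assms)
  then show ?thesis
    by (simp add: has_field_derivative_def linear_scale[OF lin] b mult.commute[of _ "sum _ _"]
        mult_commute_abs)
qed

text \<open>A function invariant under the translations preserving the coordinate is determined by its
  restriction to any line transverse to the level sets.\<close>

lemma depends_only_on_profile:
  assumes "lin_coord \<alpha> \<beta> = 1" and M: "M = {x. lin_coord \<alpha> x \<in> I}"
    and u: "twice_differentiable_on M u" "depends_only_on \<alpha> M u"
  obtains \<phi> \<phi>' \<phi>'' where "\<And>x. x \<in> M \<Longrightarrow> u x = \<phi> (lin_coord \<alpha> x)"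
    "\<And>t. t \<in> I \<Longrightarrow> (\<phi> has_real_derivative \<phi>' t) (at t)"
    "\<And>t. t \<in> I \<Longrightarrow> (\<phi>' has_real_derivative \<phi>'' t) (at t)"
proof -
  let ?du = "\<lambda>x. \<Sum>i\<in>UNIV. \<beta> $ i * partial_deriv i u x"
  have in_M: "t *\<^sub>R \<beta> \<in> M" if "t \<in> I" for t
    using assms(1) that by (simp add: M lin_coord_inner)
  have "u x = u (lin_coord \<alpha> x *\<^sub>R \<beta>)" if "x \<in> M" for x
  proof -
    let ?v = "lin_coord \<alpha> x *\<^sub>R \<beta> - x"
    have "lin_coord \<alpha> (y + ?v) = lin_coord \<alpha> y" for y
      using assms(1) by (simp add: lin_coord_inner inner_add_right inner_diff_right)
    then have "u (x + ?v) = u x" using u(2) that unfolding depends_only_on_def by blast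
    then show ?thesis by simp
  qed
  moreover have "((\<lambda>t. u (t *\<^sub>R \<beta>)) has_real_derivative ?du (t *\<^sub>R \<beta>)) (at t)" if "t \<in> I" for t
    by (rule line_derivative) (use u in_M[OF that] in \<open>auto simp: twice_differentiable_on_def\<close>)
  moreover have "((\<lambda>t. ?du (t *\<^sub>R \<beta>)) has_real_derivative
      (\<Sum>i\<in>UNIV. \<beta> $ i * partial_deriv i ?du (t *\<^sub>R \<beta>))) (at t)" if "t \<in> I" for t
  proof (rule line_derivative)
    have "(\<lambda>x. \<beta> $ i * partial_deriv i u x) differentiable (at (t *\<^sub>R \<beta>))" for i
      by (rule differentiable_mult) (use u in_M[OF that] in \<open>auto simp: twice_differentiable_on_def\<close>)
    then show "?du differentiable (at (t *\<^sub>R \<beta>))" by (intro differentiable_sum) auto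
  qed
  ultimately show thesis by (rule that)
qed

section \<open>The conformally flat base\<close>

text \<open>The metric \<open>\<epsilon> / \<psi>\<^sup>2\<close> on the slab over \<open>I\<close>, with \<open>\<psi>\<close> given by its profile along the coordinate.\<close>

locale plane_conformal_metric =
  fixes \<epsilon> :: "'n::finite \<Rightarrow> real" and \<alpha> :: "real^'n" and \<kappa> :: real and I :: "real set"
    and \<psi> \<psi>' \<psi>'' :: "real \<Rightarrow> real"
  assumes \<epsilon>: "\<And>i. \<epsilon> i = 1 \<or> \<epsilon> i = -1"
    and \<kappa>: "(\<Sum>k\<in>UNIV. \<epsilon> k * (\<alpha> $ k)\<^sup>2) = \<kappa>"
    and I: "open I"
    and \<psi>: "\<And>t. t \<in> I \<Longrightarrow> (\<psi> has_real_derivative \<psi>' t) (at t)"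
      "\<And>t. t \<in> I \<Longrightarrow> (\<psi>' has_real_derivative \<psi>'' t) (at t)"
      "\<And>t. t \<in> I \<Longrightarrow> \<psi> t \<noteq> 0"
begin

abbreviation \<xi> where "\<xi> \<equiv> lin_coord \<alpha>"
abbreviation M where "M \<equiv> {x. \<xi> x \<in> I}"

definition B :: "real^'n \<Rightarrow> real^'n^'n" where
  "B x = (\<chi> i j. if i = j then \<epsilon> i / (\<psi> (\<xi> x))\<^sup>2 else 0)"

text \<open>The logarithmic derivative of \<open>1 / \<psi>\<close>, whose square is the conformal factor, and its derivative.\<close>

definition b :: "real \<Rightarrow> real" where "b t = - \<psi>' t / \<psi> t"
definition b' :: "real \<Rightarrow> real" where "b' t = (\<psi>' t / \<psi> t)\<^sup>2 - \<psi>'' t / \<psi> t"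

text \<open>The Christoffel symbols are \<open>b\<close> times these constants.\<close>

definition \<Gamma> :: "'n \<Rightarrow> 'n \<Rightarrow> 'n \<Rightarrow> real" where
  "\<Gamma> k i j = (if j = k then \<alpha> $ i else 0) + (if i = k then \<alpha> $ j else 0)
     - (if i = j then \<epsilon> i * \<epsilon> k * \<alpha> $ k else 0)"

lemma \<epsilon>_mult_self [simp]: "\<epsilon> i * \<epsilon> i = 1" "\<epsilon> i * (\<epsilon> i * c) = c"
  using \<epsilon>[of i] by auto

lemma \<kappa>': "(\<Sum>k\<in>UNIV. \<epsilon> k * (\<alpha> $ k * \<alpha> $ k)) = \<kappa>" "(\<Sum>k\<in>UNIV. \<alpha> $ k * (\<epsilon> k * \<alpha> $ k)) = \<kappa>"
  using \<kappa> by (simp_all add: power2_eq_square mult.left_commute)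

lemma deriv_b: "t \<in> I \<Longrightarrow> (b has_real_derivative b' t) (at t)"
  unfolding b_def[abs_def] b'_def
  by (rule derivative_eq_intros \<psi> refl | assumption)+ (use \<psi>(3) in \<open>simp add: field_simps power2_eq_square\<close>)

lemma twice_differentiable_B: "twice_differentiable_on M (\<lambda>x. B x $ i $ j)"
proof (rule twice_differentiable_on_plane[OF I])
  let ?c = "if i = j then \<epsilon> i else 0"
  show "B x $ i $ j = (\<lambda>t. ?c / (\<psi> t)\<^sup>2) (\<xi> x)" for x by (simp add: B_def)
  show "((\<lambda>t. ?c / (\<psi> t)\<^sup>2) has_real_derivative ?c * (- 2 * \<psi>' t / \<psi> t ^ 3)) (at t)" if "t \<in> I" for t
    by (rule derivative_eq_intros \<psi> refl that)+ (use \<psi>(3)[OF that] in \<open>auto simp: field_simps eval_nat_numeral\<close>)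
  show "((\<lambda>t. ?c * (- 2 * \<psi>' t / \<psi> t ^ 3)) has_real_derivative
      ?c * ((- 2 * \<psi>'' t * \<psi> t ^ 3 - - 2 * \<psi>' t * (3 * \<psi> t ^ 2 * \<psi>' t)) / (\<psi> t ^ 3 * \<psi> t ^ 3))) (at t)"
    if "t \<in> I" for t
  proof (intro DERIV_cmult DERIV_divide)
    show "((\<lambda>t. \<psi> t ^ 3) has_real_derivative 3 * \<psi> t ^ 2 * \<psi>' t) (at t)"
      using DERIV_power[OF \<psi>(1)[OF that], of 3] by (simp add: mult_ac)
  qed (use \<psi> that in auto)
qed

lemma partial_deriv_B:
  assumes "x \<in> M"
  shows "partial_deriv l (\<lambda>x. B x $ i $ j) x = (if i = j then \<epsilon> i * \<alpha> $ l * (2 * b (\<xi> x) / (\<psi> (\<xi> x))\<^sup>2) else 0)"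
proof -
  let ?c = "if i = j then \<epsilon> i else 0" and ?t = "\<xi> x"
  have t: "?t \<in> I" using assms by simp
  have "((\<lambda>t. ?c / (\<psi> t)\<^sup>2) has_real_derivative ?c * (2 * b ?t / (\<psi> ?t)\<^sup>2)) (at ?t)"
    by (rule derivative_eq_intros \<psi> refl t)+ (use \<psi>(3)[OF t] in \<open>auto simp: b_def field_simps eval_nat_numeral\<close>)
  then have "partial_deriv l (\<lambda>x. B x $ i $ j) x = \<alpha> $ l * (?c * (2 * b ?t / (\<psi> ?t)\<^sup>2))"
    by (intro plane_derivatives(2)[OF open_slab[OF I] assms]) (auto simp: B_def)
  then show ?thesis by simp
qed

lemma matrix_inv_B:
  assumes "x \<in> M"
  shows "invertible (B x)" "matrix_inv (B x) = (\<chi> i j. if i = j then \<epsilon> i * (\<psi> (\<xi> x))\<^sup>2 else 0)"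
proof -
  let ?A = "(\<chi> i j. if i = j then \<epsilon> i * (\<psi> (\<xi> x))\<^sup>2 else 0) :: real^'n^'n"
  have "B x ** ?A = mat 1" "?A ** B x = mat 1"
    using \<psi>(3)[of "\<xi> x"] assms
    by (simp_all add: vec_eq_iff matrix_matrix_mult_def mat_def B_def
        if_distrib[where f = "\<lambda>t. t * _"] if_distrib[where f = "\<lambda>t. _ * t"] sum.delta cong: if_cong)
  then show "invertible (B x)" "matrix_inv (B x) = ?A"
    by (auto simp: invertible_def intro: matrix_inv_eqI)
qed

lemma christoffel_B:
  assumes "x \<in> M"
  shows "christoffel B k i j x = b (\<xi> x) * \<Gamma> k i j"
proof -
  have p: "\<psi> (\<xi> x) \<noteq> 0" using \<psi>(3) assms by simp
  have "christoffel B k i j x = 1/2 * (\<epsilon> k * (\<psi> (\<xi> x))\<^sup>2 * (partial_deriv i (\<lambda>y. B y $ j $ k) x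
      + partial_deriv j (\<lambda>y. B y $ i $ k) x - partial_deriv k (\<lambda>y. B y $ i $ j) x))"
    unfolding christoffel_def matrix_inv_B(2)[OF assms]
    by (simp add: if_distrib[where f = "\<lambda>t. t * _"] sum.delta cong: if_cong)
  also have "\<dots> = b (\<xi> x) * \<Gamma> k i j"
    using p by (auto simp: partial_deriv_B[OF assms] \<Gamma>_def field_simps)
  finally show ?thesis .
qed

lemma partial_deriv_christoffel_B:
  assumes "x \<in> M"
  shows "partial_deriv l (christoffel B k i j) x = \<alpha> $ l * (b' (\<xi> x) * \<Gamma> k i j)"
  by (rule plane_derivatives(2)[OF open_slab[OF I] assms, of _ "\<lambda>t. b t * \<Gamma> k i j"])
    (use assms in \<open>auto simp: christoffel_B intro!: DERIV_cmult_right deriv_b\<close>)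

text \<open>Only these contractions enter the Ricci tensor.  In the double sum the first factor is
  expanded: two of its Kronecker terms absorb the sum over \<open>p\<close>, and the third one leaves the first
  contraction.\<close>

lemma \<Gamma>_contractions:
  "(\<Sum>l\<in>UNIV. \<alpha> $ l * \<Gamma> l i k) = 2 * \<alpha> $ i * \<alpha> $ k - (if i = k then \<kappa> * \<epsilon> i else 0)"
  "\<Gamma> l i l = \<alpha> $ i" "\<Gamma> l l i = \<alpha> $ i"
  "(\<Sum>l\<in>UNIV. \<Sum>p\<in>UNIV. \<Gamma> l k p * \<Gamma> p i l) = (real CARD('n) + 2) * \<alpha> $ i * \<alpha> $ k - (if i = k then 2 * \<kappa> * \<epsilon> i else 0)"
proof -
  note s = if_distrib[where f = "\<lambda>t. t * _"] if_distrib[where f = "\<lambda>t. _ * t"] sum.delta sum.distrib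
    sum_subtractf sum_distrib_left[symmetric] sum_distrib_right[symmetric] 
  have kap: "(\<Sum>l\<in>UNIV. \<epsilon> l * \<alpha> $ l * (c * \<alpha> $ l)) = c * \<kappa>" for c
    by (simp add: \<kappa>'[symmetric] sum_distrib_left mult_ac)
  have A: "(\<Sum>l\<in>UNIV. \<alpha> $ l * \<Gamma> l i k) = 2 * \<alpha> $ i * \<alpha> $ k - (if i = k then \<kappa> * \<epsilon> i else 0)" for i k
  proof -
    have "(\<Sum>l\<in>UNIV. \<alpha> $ l * (\<epsilon> i * \<epsilon> l * \<alpha> $ l)) = \<kappa> * \<epsilon> i"
      by (simp add: \<kappa>'[symmetric] sum_distrib_left mult_ac)
    then show ?thesis
      by (cases "i = k") (simp_all add: \<Gamma>_def distrib_left right_diff_distrib s cong: if_cong)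
  qed
  show "(\<Sum>l\<in>UNIV. \<alpha> $ l * \<Gamma> l i k) = 2 * \<alpha> $ i * \<alpha> $ k - (if i = k then \<kappa> * \<epsilon> i else 0)" by (rule A)
  show C: "\<Gamma> l i l = \<alpha> $ i" "\<Gamma> l l i = \<alpha> $ i" for l i by (auto simp: \<Gamma>_def)
  have p: "(\<Sum>p\<in>UNIV. \<Gamma> l k p * \<Gamma> p i l) = \<alpha> $ k * \<alpha> $ i
      + (if k = l then 2 * \<alpha> $ i * \<alpha> $ k - (if i = k then \<kappa> * \<epsilon> i else 0) else 0)
      - \<epsilon> k * (\<epsilon> l * \<alpha> $ l * \<Gamma> k i l)" for l
  proof -
    have "(\<Sum>p\<in>UNIV. \<Gamma> l k p * \<Gamma> p i l) = (\<Sum>p\<in>UNIV. (if p = l then \<alpha> $ k * \<Gamma> p i l else 0)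
        + (if k = l then \<alpha> $ p * \<Gamma> p i l else 0) - (if p = k then \<epsilon> k * \<epsilon> l * \<alpha> $ l * \<Gamma> p i l else 0))"
      by (rule sum.cong) (auto simp: \<Gamma>_def[of l k] algebra_simps)
    then show ?thesis
      by (cases "k = l") (simp_all add: sum.distrib sum_subtractf C A)
  qed
  have "(\<Sum>l\<in>UNIV. \<epsilon> l * \<alpha> $ l * \<Gamma> k i l) = (\<Sum>l\<in>UNIV. (if l = k then \<epsilon> k * \<alpha> $ k * \<alpha> $ i else 0)
      + (if i = k then \<epsilon> l * (\<alpha> $ l * \<alpha> $ l) else 0) - (if l = i then \<epsilon> k * \<alpha> $ i * \<alpha> $ k else 0))"
    by (rule sum.cong) (auto simp: \<Gamma>_def algebra_simps)
  then have q: "(\<Sum>l\<in>UNIV. \<epsilon> l * \<alpha> $ l * \<Gamma> k i l) = (if i = k then \<kappa> else 0)"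
    by (cases "i = k") (simp_all add: sum.distrib sum_subtractf \<kappa>')
  show "(\<Sum>l\<in>UNIV. \<Sum>p\<in>UNIV. \<Gamma> l k p * \<Gamma> p i l) = (real CARD('n) + 2) * \<alpha> $ i * \<alpha> $ k - (if i = k then 2 * \<kappa> * \<epsilon> i else 0)"
    unfolding p sum.distrib sum_subtractf sum_distrib_left[symmetric] q
    by (simp add: algebra_simps)
qed

text \<open>Since \<open>\<Gamma>\<close> is constant and \<open>b\<close> depends on the coordinate only, differentiation brings in just the
  factor \<open>\<alpha>\<^sub>l\<close>, and the curvature becomes the contractions of \<open>\<Gamma>\<close> with coefficients \<open>b'\<close> and \<open>b\<^sup>2\<close>.\<close>

lemma ricci_B_aux:
  assumes "x \<in> M"
  shows "ricci_coords B x $ i $ k = (real CARD('n) - 2) * ((b (\<xi> x))\<^sup>2 - b' (\<xi> x)) * \<alpha> $ i * \<alpha> $ k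
    - (if i = k then \<kappa> * \<epsilon> i * (b' (\<xi> x) + (real CARD('n) - 2) * (b (\<xi> x))\<^sup>2) else 0)"
proof -
  let ?b = "b (\<xi> x)" and ?b' = "b' (\<xi> x)"
  have "riemann B l i l k x = ?b' * (\<alpha> $ l * \<Gamma> l i k) - ?b' * (\<alpha> $ k * \<alpha> $ i)
      + ?b\<^sup>2 * ((\<Sum>p\<in>UNIV. \<alpha> $ p * \<Gamma> p i k) - (\<Sum>p\<in>UNIV. \<Gamma> l k p * \<Gamma> p i l))" for l
    by (simp add: riemann_def christoffel_B[OF assms] partial_deriv_christoffel_B[OF assms] \<Gamma>_contractions(2,3)
       sum_subtractf[symmetric] sum_distrib_left power2_eq_square right_diff_distrib mult_ac)
  then have "ricci_coords B x $ i $ k = ?b' * (\<Sum>l\<in>UNIV. \<alpha> $ l * \<Gamma> l i k) - real CARD('n) * ?b' * (\<alpha> $ k * \<alpha> $ i)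
      + ?b\<^sup>2 * (real CARD('n) * (\<Sum>p\<in>UNIV. \<alpha> $ p * \<Gamma> p i k) - (\<Sum>l\<in>UNIV. \<Sum>p\<in>UNIV. \<Gamma> l k p * \<Gamma> p i l))"
    by (simp add: ricci_coords_def sum.distrib sum_subtractf sum_distrib_left[symmetric])
  also have "\<dots> = (real CARD('n) - 2) * (?b\<^sup>2 - ?b') * \<alpha> $ i * \<alpha> $ k - (if i = k then \<kappa> * \<epsilon> i * (?b' + (real CARD('n) - 2) * ?b\<^sup>2) else 0)"
    unfolding \<Gamma>_contractions by (simp add: algebra_simps)
  finally show ?thesis .
qed

lemma ricci_B:
  assumes "x \<in> M" "t = \<xi> x"
  shows "ricci_coords B x $ i $ k = (real CARD('n) - 2) * (\<psi>'' t / \<psi> t) * \<alpha> $ i * \<alpha> $ k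
    + (if i = k then \<kappa> * \<epsilon> i * (\<psi> t * \<psi>'' t - (real CARD('n) - 1) * (\<psi>' t)\<^sup>2) / (\<psi> t)\<^sup>2 else 0)"
proof -
  have "\<psi> t \<noteq> 0" using \<psi>(3) assms by simp
  then have e: "(b t)\<^sup>2 - b' t = \<psi>'' t / \<psi> t"
    "b' t + (real CARD('n) - 2) * (b t)\<^sup>2 = - (\<psi> t * \<psi>'' t - (real CARD('n) - 1) * (\<psi>' t)\<^sup>2) / (\<psi> t)\<^sup>2"
    by (simp_all add: b_def b'_def field_simps power2_eq_square)
  show ?thesis unfolding ricci_B_aux[OF assms(1), folded assms(2)] e by (simp add: diff_divide_distrib algebra_simps)
qed

lemma scalar_curvature_B:
  assumes "x \<in> M" "t = \<xi> x"
  shows "(\<Sum>i\<in>UNIV. \<Sum>j\<in>UNIV. matrix_inv (B x) $ i $ j * ricci_coords B x $ i $ j)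
    = \<kappa> * (real CARD('n) - 1) * (2 * \<psi> t * \<psi>'' t - real CARD('n) * (\<psi>' t)\<^sup>2)"
proof -
  have p: "\<psi> t \<noteq> 0" using \<psi>(3) assms by simp
  have "(\<Sum>i\<in>UNIV. \<Sum>j\<in>UNIV. matrix_inv (B x) $ i $ j * ricci_coords B x $ i $ j)
    = (\<Sum>i\<in>UNIV. \<epsilon> i * (\<psi> t)\<^sup>2 * ricci_coords B x $ i $ i)"
    unfolding matrix_inv_B(2)[OF assms(1)] assms(2)
    by (simp add: if_distrib[where f = "\<lambda>t. t * _"] sum.delta cong: if_cong)
  also have "\<dots> = (\<Sum>i\<in>UNIV. (real CARD('n) - 2) * (\<psi> t * \<psi>'' t) * (\<epsilon> i * (\<alpha> $ i * \<alpha> $ i))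
      + \<kappa> * (\<psi> t * \<psi>'' t - (real CARD('n) - 1) * (\<psi>' t)\<^sup>2))"
    unfolding ricci_B[OF assms] using p \<epsilon>
    by (intro sum.cong) (auto simp: field_simps power2_eq_square)
  also have "\<dots> = \<kappa> * (real CARD('n) - 1) * (2 * \<psi> t * \<psi>'' t - real CARD('n) * (\<psi>' t)\<^sup>2)"
    unfolding sum.distrib sum_distrib_left[symmetric] \<kappa>' by (simp add: algebra_simps)
  finally show ?thesis .
qed

end

section \<open>Warped products over the conformally flat base\<close>

locale plane_warped_product = plane_conformal_metric \<epsilon> \<alpha> \<kappa> I \<psi> \<psi>' \<psi>''
  for \<epsilon> :: "'n::finite \<Rightarrow> real" and \<alpha> \<kappa> I \<psi> \<psi>' \<psi>'' +
  fixes F F' F'' :: "real \<Rightarrow> real" and h :: "real^'m::finite \<Rightarrow> real^'m^'m" and V :: "(real^'m) set"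
  assumes F: "\<And>t. t \<in> I \<Longrightarrow> (F has_real_derivative F' t) (at t)"
      "\<And>t. t \<in> I \<Longrightarrow> (F' has_real_derivative F'' t) (at t)"
      "\<And>t. t \<in> I \<Longrightarrow> F t \<noteq> 0"
    and V: "open V"
    and h: "\<And>a b. twice_differentiable_on V (\<lambda>v. h v $ a $ b)" "\<And>v. v \<in> V \<Longrightarrow> invertible (h v)"
      "\<And>v. v \<in> V \<Longrightarrow> transpose (h v) = h v"

sublocale plane_warped_product \<subseteq> wc: warped_coordinates B "\<lambda>x. F (\<xi> x)" h M V
proof
  show "twice_differentiable_on M (\<lambda>x. F (\<xi> x))"
    by (rule twice_differentiable_on_plane[OF I _ F(1,2)]) auto
qed (use open_slab[OF I] V twice_differentiable_B matrix_inv_B F h in auto)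

context plane_warped_product
begin

lemma log_grad_plane:
  assumes "x \<in> M" "t = \<xi> x"
  shows "wc.log_grad i x = \<alpha> $ i * (F' t / F t)"
    "partial_deriv j (wc.log_grad i) x = \<alpha> $ j * (\<alpha> $ i * (F'' t / F t - (F' t / F t)\<^sup>2))"
proof -
  have 1: "wc.log_grad i x = \<alpha> $ i * (F' (\<xi> x) / F (\<xi> x))" if "x \<in> M" for x
    using that plane_derivatives(2)[OF open_slab[OF I] that, of _ F \<alpha>, OF refl F(1)]
    by (simp add: wc.log_grad_def)
  then show "wc.log_grad i x = \<alpha> $ i * (F' t / F t)" using assms by simp
  have t: "t \<in> I" using assms by simp
  have "((\<lambda>t. F' t / F t) has_real_derivative (F'' t * F t - F' t * F' t) / (F t * F t)) (at t)"
    by (intro DERIV_divide F t)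
  moreover have "(F'' t * F t - F' t * F' t) / (F t * F t) = F'' t / F t - (F' t / F t)\<^sup>2"
    using F(3)[OF t] by (simp add: field_simps power2_eq_square)
  ultimately have "((\<lambda>t. \<alpha> $ i * (F' t / F t)) has_real_derivative \<alpha> $ i * (F'' t / F t - (F' t / F t)\<^sup>2)) (at t)"
    by (intro DERIV_cmult) simp
  then show "partial_deriv j (wc.log_grad i) x = \<alpha> $ j * (\<alpha> $ i * (F'' t / F t - (F' t / F t)\<^sup>2))"
    by (intro plane_derivatives(2)[OF open_slab[OF I] assms(1)]) (auto simp: 1 assms(2))
qed

lemma warp_grad_plane:
  assumes "x \<in> M" "t = \<xi> x"
  shows "wc.warp_grad k x = \<epsilon> k * \<alpha> $ k * (F t * F' t * (\<psi> t)\<^sup>2)"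
    "partial_deriv l (wc.warp_grad k) x = \<alpha> $ l * (\<epsilon> k * \<alpha> $ k *
      ((F' t)\<^sup>2 * (\<psi> t)\<^sup>2 + F t * F'' t * (\<psi> t)\<^sup>2 + 2 * F t * F' t * \<psi> t * \<psi>' t))"
proof -
  have 1: "wc.warp_grad k x = \<epsilon> k * \<alpha> $ k * (F (\<xi> x) * F' (\<xi> x) * (\<psi> (\<xi> x))\<^sup>2)" if "x \<in> M" for x
    using that plane_derivatives(2)[OF open_slab[OF I] that, of _ F \<alpha>, OF refl F(1)]
    by (simp add: wc.warp_grad_def matrix_inv_B if_distrib[where f = "\<lambda>t. t * _"] sum.delta cong: if_cong)
  then show "wc.warp_grad k x = \<epsilon> k * \<alpha> $ k * (F t * F' t * (\<psi> t)\<^sup>2)" using assms by simp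
  have t: "t \<in> I" using assms by simp
  have "((\<lambda>t. F t * F' t * (\<psi> t)\<^sup>2) has_real_derivative
      ((F' t)\<^sup>2 * (\<psi> t)\<^sup>2 + F t * F'' t * (\<psi> t)\<^sup>2 + 2 * F t * F' t * \<psi> t * \<psi>' t)) (at t)"
    by (auto intro!: derivative_eq_intros F \<psi> t simp: algebra_simps power2_eq_square)
  then have "((\<lambda>t. \<epsilon> k * \<alpha> $ k * (F t * F' t * (\<psi> t)\<^sup>2)) has_real_derivative \<epsilon> k * \<alpha> $ k *
      ((F' t)\<^sup>2 * (\<psi> t)\<^sup>2 + F t * F'' t * (\<psi> t)\<^sup>2 + 2 * F t * F' t * \<psi> t * \<psi>' t)) (at t)"
    by (rule DERIV_cmult)
  then show "partial_deriv l (wc.warp_grad k) x = \<alpha> $ l * (\<epsilon> k * \<alpha> $ k *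
      ((F' t)\<^sup>2 * (\<psi> t)\<^sup>2 + F t * F'' t * (\<psi> t)\<^sup>2 + 2 * F t * F' t * \<psi> t * \<psi>' t))"
    by (intro plane_derivatives(2)[OF open_slab[OF I] assms(1)]) (auto simp: 1 assms(2))
qed

text \<open>The base block is a combination of the two tensors \<open>\<alpha> \<otimes> \<alpha>\<close> and \<open>\<epsilon>\<close>; their coefficients give the
  first two differential equations.\<close>

lemma ricci_base_plane:
  assumes y: "y \<in> wc.W" and t: "t = \<xi> (base_part y)"
  shows "ricci_coords wc.G y $ Inl i $ Inl j =
    ((real CARD('n) - 2) * (\<psi>'' t / \<psi> t)
      - real CARD('m) * (F'' t / F t + 2 * (\<psi>' t / \<psi> t) * (F' t / F t))) * \<alpha> $ i * \<alpha> $ j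
    + (if i = j then \<epsilon> i * (\<kappa> * (\<psi> t * \<psi>'' t - (real CARD('n) - 1) * (\<psi>' t)\<^sup>2
        + real CARD('m) * \<psi> t * \<psi>' t * (F' t / F t)) / (\<psi> t)\<^sup>2) else 0)"
proof -
  let ?x = "base_part y" and ?u = "F' t / F t"
  have x: "?x \<in> M" using wc.W_parts y by blast
  have p: "\<psi> t \<noteq> 0" using x t \<psi>(3) by simp
  have "(\<Sum>p\<in>UNIV. wc.log_grad p ?x * christoffel B p i j ?x) = ?u * b t * (\<Sum>p\<in>UNIV. \<alpha> $ p * \<Gamma> p i j)"
    unfolding sum_distrib_left
    by (rule sum.cong) (simp_all add: log_grad_plane(1)[OF x t] christoffel_B[OF x] t)
  also have "\<dots> = - (?u * (\<psi>' t / \<psi> t) * (2 * \<alpha> $ i * \<alpha> $ j - (if i = j then \<kappa> * \<epsilon> i else 0)))"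
    unfolding \<Gamma>_contractions(1) by (simp add: b_def)
  finally have s: "(\<Sum>p\<in>UNIV. wc.log_grad p ?x * christoffel B p i j ?x) =
    - (?u * (\<psi>' t / \<psi> t) * (2 * \<alpha> $ i * \<alpha> $ j - (if i = j then \<kappa> * \<epsilon> i else 0)))" .
  have q: "\<psi> t * \<psi>' t * ?u / (\<psi> t)\<^sup>2 = ?u * (\<psi>' t / \<psi> t)"
    using p by (simp add: power2_eq_square)
  have e: "\<epsilon> i * (\<kappa> * (A + real CARD('m) * \<psi> t * \<psi>' t * ?u) / (\<psi> t)\<^sup>2)
      = \<kappa> * \<epsilon> i * A / (\<psi> t)\<^sup>2 + real CARD('m) * \<kappa> * \<epsilon> i * (?u * (\<psi>' t / \<psi> t))" for A
    unfolding q[symmetric] using p by (simp add: field_simps)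
  show ?thesis
    unfolding wc.ricci_base[OF y] s
    unfolding log_grad_plane[OF x t] ricci_B[OF x t] e
    by (simp add: algebra_simps power2_eq_square)
qed

lemma ricci_fibre_plane:
  assumes y: "y \<in> wc.W" and t: "t = \<xi> (base_part y)"
  shows "ricci_coords wc.G y $ Inr a $ Inr c = ricci_coords h (fibre_part y) $ a $ c
    - \<kappa> * h (fibre_part y) $ a $ c * (F t * F'' t * (\<psi> t)\<^sup>2
      + (real CARD('m) - 1) * (F' t)\<^sup>2 * (\<psi> t)\<^sup>2 - (real CARD('n) - 2) * F t * F' t * \<psi> t * \<psi>' t)"
proof -
  let ?x = "base_part y"
  have x: "?x \<in> M" using wc.W_parts y by blast
  have p: "\<psi> t \<noteq> 0" "F t \<noteq> 0" using x t \<psi>(3) F(3) by simp_all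
  have kap: "(\<Sum>l\<in>UNIV. \<alpha> $ l * (\<epsilon> l * \<alpha> $ l * c)) = \<kappa> * c" for c
    unfolding \<kappa>'(2)[symmetric] sum_distrib_right by (rule sum.cong) simp_all
  have 1: "(\<Sum>l\<in>UNIV. partial_deriv l (wc.warp_grad l) ?x) = \<kappa> * ((F' t)\<^sup>2 * (\<psi> t)\<^sup>2 + F t * F'' t * (\<psi> t)\<^sup>2 + 2 * F t * F' t * \<psi> t * \<psi>' t)"
    unfolding warp_grad_plane[OF x t] kap ..
  have 2: "(\<Sum>p\<in>UNIV. christoffel B l l p ?x * wc.warp_grad p ?x) = \<kappa> * (b t * (F t * F' t * (\<psi> t)\<^sup>2))" for l
    unfolding warp_grad_plane[OF x t] christoffel_B[OF x] \<Gamma>_contractions(3) t[symmetric] kap[symmetric]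
    by (simp add: mult_ac)
  have b: "b t * (F t * F' t * (\<psi> t)\<^sup>2) = - (F t * F' t * \<psi> t * \<psi>' t)"
    using p by (simp add: b_def power2_eq_square)
  have "(\<Sum>l\<in>UNIV. wc.log_grad l ?x * wc.warp_grad l ?x) = \<kappa> * (F' t / F t * (F t * F' t * (\<psi> t)\<^sup>2))"
    unfolding warp_grad_plane[OF x t] log_grad_plane[OF x t] kap[symmetric] by (simp add: mult_ac)
  also have "\<dots> = \<kappa> * ((F' t)\<^sup>2 * (\<psi> t)\<^sup>2)" using p by (simp add: power2_eq_square)
  finally have 3: "(\<Sum>l\<in>UNIV. wc.log_grad l ?x * wc.warp_grad l ?x) = \<kappa> * ((F' t)\<^sup>2 * (\<psi> t)\<^sup>2)" .
  show ?thesis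
    unfolding wc.ricci_fibre[OF y] sum.distrib 1 2 3 b by (simp add: algebra_simps)
qed

end

section \<open>The ordinary differential equations\<close>

text \<open>A tensor of rank one and a nondegenerate one are linearly independent in dimension at least two.
  Taking the trace with \<open>\<epsilon>\<close> and the contraction with the gradient of the coordinate gives two equations
  for \<open>P\<close> and \<open>R\<close> with determinant \<open>\<plusminus>(n - 1)\<close>.\<close>

lemma vanishing_plane_tensor:
  fixes \<epsilon> :: "'n::finite \<Rightarrow> real"
  assumes \<epsilon>: "\<And>i. \<epsilon> i = 1 \<or> \<epsilon> i = -1" and \<kappa>: "(\<Sum>k\<in>UNIV. \<epsilon> k * (\<alpha> $ k)\<^sup>2) = \<kappa>" "\<kappa> = 1 \<or> \<kappa> = -1"
    and n: "CARD('n) \<ge> 2"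
    and eq: "\<And>i j. P * \<alpha> $ i * \<alpha> $ j + (if i = j then \<epsilon> i * R else 0) = 0"
  shows "P = 0" "R = 0"
proof -
  have e1: "\<epsilon> i * \<epsilon> i = 1" "\<epsilon> i * (\<epsilon> i * c) = c" for i c using \<epsilon>[of i] by auto
  have "0 = (\<Sum>i\<in>UNIV. \<epsilon> i * (P * \<alpha> $ i * \<alpha> $ i + (if i = i then \<epsilon> i * R else 0)))"
    unfolding eq by simp
  also have "\<dots> = (\<Sum>i\<in>UNIV. P * (\<epsilon> i * (\<alpha> $ i)\<^sup>2) + R)"
    by (rule sum.cong) (simp_all add: distrib_left e1 power2_eq_square mult_ac)
  also have "\<dots> = P * \<kappa> + real CARD('n) * R"
    unfolding sum.distrib sum_distrib_left[symmetric] \<kappa> by simp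
  finally have tr: "P * \<kappa> + real CARD('n) * R = 0" by simp
  have "0 = (\<Sum>j\<in>UNIV. \<epsilon> j * \<alpha> $ j * (P * \<alpha> $ i * \<alpha> $ j + (if i = j then \<epsilon> i * R else 0)))" for i
    unfolding eq by simp
  also have "\<dots> i = (\<Sum>j\<in>UNIV. P * \<alpha> $ i * (\<epsilon> j * (\<alpha> $ j)\<^sup>2) + (if j = i then \<alpha> $ i * R else 0))" for i
    by (rule sum.cong) (auto simp: distrib_left e1 power2_eq_square mult_ac)
  also have "\<dots> i = (P * \<kappa> + R) * \<alpha> $ i" for i
    unfolding sum.distrib sum_distrib_left[symmetric] \<kappa> by (simp add: algebra_simps)
  finally have "(P * \<kappa> + R) * \<alpha> $ i = 0" for i by simp
  moreover have "\<exists>i. \<alpha> $ i \<noteq> 0"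
  proof (rule ccontr)
    assume "\<not> ?thesis" then show False using \<kappa> by simp
  qed
  ultimately have r: "P * \<kappa> + R = 0" by auto
  have "(real CARD('n) - 1) * R = (P * \<kappa> + real CARD('n) * R) - (P * \<kappa> + R)"
    by (simp add: algebra_simps)
  then have "(real CARD('n) - 1) * R = 0" unfolding tr r by simp
  then show "R = 0" using n by simp
  with r \<kappa>(2) show "P = 0" by auto
qed

lemma derivative_zero_constant_on_interval:
  fixes g :: "real \<Rightarrow> real"
  assumes "is_interval I" "\<And>t. t \<in> I \<Longrightarrow> (g has_real_derivative 0) (at t)"
  obtains c where "\<And>t. t \<in> I \<Longrightarrow> g t = c"
proof -
  have "(g has_real_derivative 0) (at t within I)" if "t \<in> I" for t
    using assms(2)[OF that] by (rule has_field_derivative_at_within)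
  then obtain c where "\<And>t. t \<in> I \<Longrightarrow> g t = c"
    using has_field_derivative_zero_constant[of I g] is_interval_convex[OF assms(1)] by blast
  then show thesis by (rule that)
qed

text \<open>At a fixed point, put \<open>p = \<psi>'\<close>, \<open>q = \<psi> \<psi>''\<close>, \<open>w = \<psi> f' / f\<close> and \<open>z = \<psi>\<^sup>2 f'' / f\<close>.  The Einstein
  equations and the constancy of the scalar curvature are then four algebraic equations.  The last one
  gives \<open>q\<close>, the second one \<open>m p w\<close>, both as polynomials in \<open>p\<^sup>2\<close>, and the first one expresses \<open>z\<close> by
  them; substitution into the third one, multiplied by \<open>m\<^sup>2 p\<^sup>2\<close> so as not to divide by
  \<open>p\<close>, leaves an equation for \<open>p\<close> with constant coefficients.  Its leading coefficient is nonzero when \<open>n > 2\<close> and \<open>m > 1\<close>.\<close>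

lemma slope_quartic:
  fixes n m p q w z L c :: real
  assumes "(n - 2) * q = m * (z + 2 * p * w)"
    and "q - (n - 1) * p\<^sup>2 + m * p * w = L"
    and "z + (m - 1) * w\<^sup>2 - (n - 2) * p * w = - L"
    and "2 * q - n * p\<^sup>2 = c"
  shows "(m - 1) * (L - c/2)\<^sup>2 + (m * (n - 2) * c / 2 - n * m * (L - c/2)
      + (m - 1) * (n - 2) * (L - c/2) + L * m\<^sup>2) * p\<^sup>2 + (m - 1) * ((n - 2) / 2)\<^sup>2 * p ^ 4 = 0"
proof -
  define D where "D = m * p * w"
  have q: "q = (c + n * p\<^sup>2) / 2" using assms(4) by simp
  have D: "D = L - c/2 + (n - 2) / 2 * p\<^sup>2"
    using assms(2) unfolding D_def q by (simp add: field_simps)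
  have "m\<^sup>2 * p\<^sup>2 * (z + (m - 1) * w\<^sup>2 - (n - 2) * p * w + L)
      = m * p\<^sup>2 * (m * (z + 2 * p * w)) + (m - 1) * D\<^sup>2 - n * m * p\<^sup>2 * D + L * m\<^sup>2 * p\<^sup>2"
    unfolding D_def by (simp add: algebra_simps power2_eq_square)
  then have "0 = m * p\<^sup>2 * ((n - 2) * q) + (m - 1) * D\<^sup>2 - n * m * p\<^sup>2 * D + L * m\<^sup>2 * p\<^sup>2"
    using assms(1,3) by simp
  then show ?thesis unfolding q D
    by (simp add: field_simps power2_eq_square power4_eq_xxxx)
qed

text \<open>By the quartic, \<open>\<psi>'\<close> is a constant \<open>a\<close>, so \<open>\<psi>'' = 0\<close>.  If \<open>a = 0\<close>, the equations leave \<open>w = 0\<close>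
  for \<open>w = \<psi> f' / f\<close>, and \<open>f\<close> is constant.  Otherwise the second equation makes \<open>w\<close> constant, the first
  one reads \<open>z = - 2 a w\<close>, and differentiating \<open>\<psi> f' = w f\<close> yields \<open>w (w + a) = 0\<close>.  The case
  \<open>w = 0\<close> is that of a constant \<open>f\<close>, and \<open>w = - a\<close> says that \<open>\<psi> f\<close> is constant.\<close>

lemma einstein_profile_odes:
  fixes \<psi> \<psi>' \<psi>'' F F' F'' :: "real \<Rightarrow> real" and n m L c :: real
  assumes I: "I \<noteq> {}" "open I" "is_interval I" and nm: "n > 2" "m > 1"
    and \<psi>: "\<And>t. t \<in> I \<Longrightarrow> (\<psi> has_real_derivative \<psi>' t) (at t)"
      "\<And>t. t \<in> I \<Longrightarrow> (\<psi>' has_real_derivative \<psi>'' t) (at t)" "\<And>t. t \<in> I \<Longrightarrow> \<psi> t \<noteq> 0"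
    and F: "\<And>t. t \<in> I \<Longrightarrow> (F has_real_derivative F' t) (at t)"
      "\<And>t. t \<in> I \<Longrightarrow> (F' has_real_derivative F'' t) (at t)" "\<And>t. t \<in> I \<Longrightarrow> F t > 0"
    and nonconst: "\<not> (\<exists>k. \<forall>t\<in>I. F t = k)"
    and E1: "\<And>t. t \<in> I \<Longrightarrow> (n - 2) * (\<psi>'' t / \<psi> t) = m * (F'' t / F t + 2 * (\<psi>' t / \<psi> t) * (F' t / F t))"
    and E2: "\<And>t. t \<in> I \<Longrightarrow> \<psi> t * \<psi>'' t - (n - 1) * (\<psi>' t)\<^sup>2 + m * \<psi> t * \<psi>' t * (F' t / F t) = L"
    and E3: "\<And>t. t \<in> I \<Longrightarrow> F t * F'' t * (\<psi> t)\<^sup>2 + (m - 1) * (F' t)\<^sup>2 * (\<psi> t)\<^sup>2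
        - (n - 2) * F t * F' t * \<psi> t * \<psi>' t = - L * (F t)\<^sup>2"
    and E4: "\<And>t. t \<in> I \<Longrightarrow> 2 * \<psi> t * \<psi>'' t - n * (\<psi>' t)\<^sup>2 = c"
  obtains a \<Theta> d where "a \<noteq> 0" "\<Theta> > 0" "\<And>t. t \<in> I \<Longrightarrow> \<psi> t = a * t + d" "\<And>t. t \<in> I \<Longrightarrow> F t * \<bar>\<psi> t\<bar> = \<Theta>"
proof -
  define w where "w t = \<psi> t * F' t / F t" for t
  define z where "z t = (\<psi> t)\<^sup>2 * F'' t / F t" for t
  have e1: "(n - 2) * (\<psi> t * \<psi>'' t) = m * (z t + 2 * \<psi>' t * w t)" if t: "t \<in> I" for t
  proof -
    have "(\<psi> t)\<^sup>2 * ((n - 2) * (\<psi>'' t / \<psi> t)) = (n - 2) * (\<psi> t * \<psi>'' t)"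
      "(\<psi> t)\<^sup>2 * (m * (F'' t / F t + 2 * (\<psi>' t / \<psi> t) * (F' t / F t))) = m * (z t + 2 * \<psi>' t * w t)"
      using \<psi>(3)[OF t] F(3)[OF t] by (simp_all add: w_def z_def field_simps power2_eq_square)
    then show ?thesis unfolding E1[OF t] by simp
  qed
  have e2: "\<psi> t * \<psi>'' t - (n - 1) * (\<psi>' t)\<^sup>2 + m * \<psi>' t * w t = L" if t: "t \<in> I" for t
    using E2[OF t] by (simp add: w_def mult_ac)
  have e3: "z t + (m - 1) * (w t)\<^sup>2 - (n - 2) * \<psi>' t * w t = - L" if t: "t \<in> I" for t
  proof -
    have "(F t)\<^sup>2 * (z t + (m - 1) * (w t)\<^sup>2 - (n - 2) * \<psi>' t * w t) = F t * F'' t * (\<psi> t)\<^sup>2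
        + (m - 1) * (F' t)\<^sup>2 * (\<psi> t)\<^sup>2 - (n - 2) * F t * F' t * \<psi> t * \<psi>' t"
      using F(3)[OF t] by (simp add: w_def z_def field_simps power2_eq_square)
    then have "(F t)\<^sup>2 * (z t + (m - 1) * (w t)\<^sup>2 - (n - 2) * \<psi>' t * w t) = (F t)\<^sup>2 * (- L)"
      using E3[OF t] by simp
    moreover have "(F t)\<^sup>2 \<noteq> 0" using F(3)[OF t] by simp
    ultimately show ?thesis using mult_left_cancel by blast
  qed
  have e4: "2 * (\<psi> t * \<psi>'' t) - n * (\<psi>' t)\<^sup>2 = c" if "t \<in> I" for t
    using E4[OF that] by simp
  have F_const: False if "\<And>t. t \<in> I \<Longrightarrow> F' t = 0"
    using derivative_zero_constant_on_interval[OF I(3), of F] F(1) that nonconst by metis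
  \<comment> \<open>The slope takes finitely many values, and so only one, by continuity.\<close>
  define A0 A1 A2 where "A0 = (m - 1) * (L - c/2)\<^sup>2"
    and "A1 = m * (n - 2) * c / 2 - n * m * (L - c/2) + (m - 1) * (n - 2) * (L - c/2) + L * m\<^sup>2"
    and "A2 = (m - 1) * ((n - 2) / 2)\<^sup>2"
  have "A2 \<noteq> 0" using nm by (simp add: A2_def)
  then have fin: "finite {s. poly [:A0, 0, A1, 0, A2:] s = 0}"
    by (intro poly_roots_finite) auto
  have "poly [:A0, 0, A1, 0, A2:] (\<psi>' t) = 0" if "t \<in> I" for t
    using slope_quartic[OF e1 e2 e3 e4, OF that that that that]
    by (simp add: A0_def A1_def A2_def power2_eq_square power4_eq_xxxx algebra_simps)
  then have "finite (\<psi>' ` I)" by (intro finite_subset[OF _ fin]) auto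
  moreover have "connected (\<psi>' ` I)"
    by (intro connected_continuous_image is_interval_connected I(3) continuous_at_imp_continuous_on ballI)
      (rule DERIV_isCont, rule \<psi>(2))
  ultimately have "\<psi>' ` I = {} \<or> (\<exists>a. \<psi>' ` I = {a})"
    using connected_finite_iff_sing by blast
  then obtain a where a: "\<And>t. t \<in> I \<Longrightarrow> \<psi>' t = a" using I(1) by blast
  have psi'': "\<psi>'' t = 0" if "t \<in> I" for t
  proof -
    have "(\<psi>' has_real_derivative 0) (at t)"
      using has_field_derivative_transform_within_open[OF DERIV_const I(2) that, of a \<psi>'] a by simp
    then show ?thesis using \<psi>(2)[OF that] DERIV_unique by blast
  qed
  have w: "m * a * w t = L + (n - 1) * a\<^sup>2" and z: "z t = - 2 * a * w t" if "t \<in> I" for t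
    using e1[OF that] e2[OF that] nm by (simp_all add: psi'' a that)
  have "a \<noteq> 0"
  proof
    assume "a = 0"
    have "F' t = 0" if t: "t \<in> I" for t
    proof -
      (* with zero slope the second equation gives L = 0 and the first one z = 0 *)
      have "(m - 1) * (w t)\<^sup>2 = 0" using e3[OF t] w[OF t] z[OF t] a[OF t] \<open>a = 0\<close> by simp
      then show ?thesis using nm \<psi>(3)[OF t] F(3)[OF t] by (simp add: w_def)
    qed
    then show False by (rule F_const)
  qed
  define w0 where "w0 = (L + (n - 1) * a\<^sup>2) / (m * a)"
  have w0: "w t = w0" if "t \<in> I" for t
    using w[OF that] \<open>a \<noteq> 0\<close> nm by (simp add: w0_def field_simps)
  have psiF': "\<psi> t * F' t = w0 * F t" if t: "t \<in> I" for t
    using w0[OF t] F(3)[OF t] by (simp add: w_def field_simps)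
  have "w0 \<noteq> 0"
    using F_const psiF' \<psi>(3) by (metis mult_eq_0_iff)
  have "w0 = - a"
  proof -
    obtain t where t: "t \<in> I" using I(1) by blast
    have "((\<lambda>t. \<psi> t * F' t) has_real_derivative a * F' t + F'' t * \<psi> t) (at t)"
      using DERIV_mult[OF \<psi>(1)[OF t] F(2)[OF t]] by (simp add: a t)
    moreover have "((\<lambda>t. \<psi> t * F' t) has_real_derivative w0 * F' t) (at t)"
      by (rule has_field_derivative_transform_within_open[OF DERIV_cmult[OF F(1)[OF t]] I(2) t])
        (simp add: psiF')
    ultimately have "a * F' t + F'' t * \<psi> t = w0 * F' t" by (rule DERIV_unique)
    then have "(a * F' t + F'' t * \<psi> t) * (\<psi> t / F t) = w0 * F' t * (\<psi> t / F t)" by simp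
    then have "a * w t + z t = w0 * w t"
      by (simp add: w_def z_def power2_eq_square algebra_simps)
    then have "w0 * (w0 + a) = 0" using z[OF t] w0[OF t] by (simp add: algebra_simps)
    then show ?thesis using \<open>w0 \<noteq> 0\<close> by (simp add: add_eq_0_iff2)
  qed
  have "((\<lambda>t. \<psi> t - a * t) has_real_derivative 0) (at t)" if "t \<in> I" for t
    using DERIV_diff[OF \<psi>(1)[OF that] DERIV_cmult[OF DERIV_ident], of a] by (simp add: a that)
  then obtain d where d: "\<And>t. t \<in> I \<Longrightarrow> \<psi> t - a * t = d"
    using derivative_zero_constant_on_interval[OF I(3)] by metis
  have "((\<lambda>t. \<psi> t * F t) has_real_derivative 0) (at t)" if "t \<in> I" for t
    using DERIV_mult[OF \<psi>(1)[OF that] F(1)[OF that]] psiF'[OF that] \<open>w0 = - a\<close>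
    by (simp add: a that mult.commute)
  then obtain k where k: "\<And>t. t \<in> I \<Longrightarrow> \<psi> t * F t = k"
    using derivative_zero_constant_on_interval[OF I(3)] by metis
  show thesis
  proof (rule that[OF \<open>a \<noteq> 0\<close>])
    obtain t where t: "t \<in> I" using I(1) by blast
    show "\<bar>k\<bar> > 0" using k[OF t] \<psi>(3)[OF t] F(3)[OF t] by auto
    show "\<psi> t = a * t + d" if "t \<in> I" for t using d[OF that] by simp
    show "F t * \<bar>\<psi> t\<bar> = \<bar>k\<bar>" if "t \<in> I" for t
      unfolding k[OF that, symmetric] using F(3)[OF that] by (simp add: abs_mult)
  qed
qed

section \<open>From charts to coordinates\<close>

lemma chart_inv_eqI:
  assumes "inj_on (coord S c) (chart_dom S c)" "p \<in> chart_dom S c" "coord S c p = y"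
  shows "chart_inv S c y = p"
  unfolding chart_inv_def using assms by (rule inv_into_f_eq)

lemma smooth_manifold_chart:
  assumes "smooth_manifold N" "e \<in> charts N"
  shows "inj_on (coord N e) (chart_dom N e)" "open (coord N e ` chart_dom N e)"
proof -
  have hom: "homeomorphic_map (subtopology (topo N) (chart_dom N e))
      (top_of_set (coord N e ` chart_dom N e)) (coord N e)"
    and op: "openin (topo N) (chart_dom N e)" and "open (coord N e ` chart_dom N e)"
    using assms unfolding smooth_manifold_def by blast+
  then show "open (coord N e ` chart_dom N e)" by blast
  have "topspace (subtopology (topo N) (chart_dom N e)) = chart_dom N e"
    using openin_subset[OF op] by auto
  then show "inj_on (coord N e) (chart_dom N e)"
    using homeomorphic_imp_injective_map[OF hom] by simp
qed

lemma smooth_manifold_has_point: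
  assumes "smooth_manifold N"
  obtains e q where "e \<in> charts N" "q \<in> chart_dom N e"
  using assms unfolding smooth_manifold_def by blast

text \<open>The components of a metric in a chart, transported to coordinate space, have arbitrary values off the
  image of the chart.  The Ricci tensor is local, so it can be computed from any expression \<open>B\<close>, \<open>F\<close> which is
  correct on that image.\<close>

lemma ricci_warped_product:
  fixes S :: "('p, 'c, 'n::finite) semi_riem" and N :: "('q, 'e, 'm::finite) semi_riem"
  assumes inj: "inj_on (coord S c) (chart_dom S c)" "inj_on (coord N e) (chart_dom N e)"
    and op: "open (coord S c ` chart_dom S c)" "open (coord N e ` chart_dom N e)"
    and B: "\<And>x. x \<in> coord S c ` chart_dom S c \<Longrightarrow> metr S c (chart_inv S c x) = B x"
    and f: "\<And>x. x \<in> coord S c ` chart_dom S c \<Longrightarrow> f (chart_inv S c x) = F x"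
    and p: "p \<in> chart_dom S c" "q \<in> chart_dom N e"
    and y: "y = coord (warped_product S f N) (c, e) (p, q)"
  shows "ricci (warped_product S f N) (c, e) (p, q) =
      ricci_coords (warped_metric B F (\<lambda>v. metr N e (chart_inv N e v))) y"
    and "metr (warped_product S f N) (c, e) (p, q) =
      warped_metric B F (\<lambda>v. metr N e (chart_inv N e v)) y"
    and "base_part y = coord S c p" "fibre_part y = coord N e q"
proof -
  let ?P = "warped_product S f N" and ?G = "warped_metric B F (\<lambda>v. metr N e (chart_inv N e v))"
  let ?U = "coord S c ` chart_dom S c" and ?V = "coord N e ` chart_dom N e"
  let ?W = "{y. base_part y \<in> ?U \<and> fibre_part y \<in> ?V}"
  have parts: "base_part (coord ?P (c, e) (p, q)) = coord S c p"
    "fibre_part (coord ?P (c, e) (p, q)) = coord N e q" for p q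
    by (simp_all add: warped_product_def base_part_def fibre_part_def vec_eq_iff)
  have eq_parts: "y = y'" if "base_part y = base_part y'" "fibre_part y = fibre_part y'" for y y' :: "real^('n + 'm)"
    using that by (simp add: vec_eq_iff base_part_def fibre_part_def split_sum_all)
  have inj': "inj_on (coord ?P (c, e)) (chart_dom ?P (c, e))"
  proof (rule inj_onI, clarify)
    fix p q p' q'
    assume a: "(p, q) \<in> chart_dom ?P (c, e)" "(p', q') \<in> chart_dom ?P (c, e)"
      and "coord ?P (c, e) (p, q) = coord ?P (c, e) (p', q')"
    then have "coord S c p = coord S c p'" "coord N e q = coord N e q'" using parts by metis+
    with a show "p = p' \<and> q = q'" using inj by (auto simp: warped_product_def inj_on_def)
  qed
  have m: "metr ?P (c, e) (p, q) = ?G (coord ?P (c, e) (p, q))"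
    if "p \<in> chart_dom S c" "q \<in> chart_dom N e" for p q
  proof -
    have inv: "chart_inv S c (coord S c p) = p" "chart_inv N e (coord N e q) = q"
      using that by (auto intro: chart_inv_eqI inj)
    then have "metr S c p = B (coord S c p)" "f p = F (coord S c p)"
      using B[of "coord S c p"] f[of "coord S c p"] that by simp_all
    with inv show ?thesis
      unfolding warped_metric_def parts
      by (auto simp: warped_product_def block_diag_def vec_eq_iff split: sum.split)
  qed
  have G: "metr ?P (c, e) (chart_inv ?P (c, e) y) = ?G y" if W: "y \<in> ?W" for y
  proof -
    obtain p q where pq: "p \<in> chart_dom S c" "q \<in> chart_dom N e"
      "base_part y = coord S c p" "fibre_part y = coord N e q" using W by blast
    have "coord ?P (c, e) (p, q) = y" by (rule eq_parts) (simp_all add: parts pq)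
    moreover have "(p, q) \<in> chart_dom ?P (c, e)" using pq by (simp add: warped_product_def)
    ultimately have "chart_inv ?P (c, e) y = (p, q)" by (intro chart_inv_eqI inj')
    then show ?thesis using m[OF pq(1,2)] \<open>coord ?P (c, e) (p, q) = y\<close> by simp
  qed
  have W: "open ?W" using op by (rule open_parts)
  show "base_part y = coord S c p" "fibre_part y = coord N e q" by (simp_all add: parts y)
  then have "y \<in> ?W" using p by simp
  show "ricci ?P (c, e) (p, q) = ricci_coords ?G y"
    unfolding ricci_def y[symmetric] by (rule ricci_coords_cong[OF W \<open>y \<in> ?W\<close> G])
  show "metr ?P (c, e) (p, q) = ?G y" using m[OF p] y by simp
qed

lemma conformal_pseudo_euclidean_simps [simp]:
  "charts (conformal_change u (pseudo_euclidean M \<epsilon>)) = {()}"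
  "chart_dom (conformal_change u (pseudo_euclidean M \<epsilon>)) c = M"
  "coord (conformal_change u (pseudo_euclidean M \<epsilon>)) c x = x"
  "metr (conformal_change u (pseudo_euclidean M \<epsilon>)) c x = u x *\<^sub>R (\<chi> i j. if i = j then \<epsilon> i else 0)"
  by (simp_all add: conformal_change_def pseudo_euclidean_def)

lemma chart_inv_conformal_pseudo_euclidean:
  "x \<in> M \<Longrightarrow> chart_inv (conformal_change u (pseudo_euclidean M \<epsilon>)) c x = x"
  by (rule chart_inv_eqI) (auto simp: inj_on_def)

theorem theorem5:
  fixes N :: "('q, 'e, 'm::finite) semi_riem"
    and \<epsilon> :: "'n::finite \<Rightarrow> real" and \<alpha> :: "real^'n" and \<kappa> l :: real
    and I :: "real set" and M :: "(real^'n) set"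
    and \<psi> f :: "real^'n \<Rightarrow> real"
  assumes n: "CARD('n) \<ge> 3" and m: "CARD('m) \<ge> 2"
    and N: "semi_riemannian_manifold N" "ricci_flat N"
    and \<epsilon>: "\<And>i. \<epsilon> i = 1 \<or> \<epsilon> i = -1" "\<exists>i. \<epsilon> i = 1"
    and \<kappa>: "(\<Sum>k\<in>UNIV. \<epsilon> k * (\<alpha> $ k)\<^sup>2) = \<kappa>" "\<kappa> = 1 \<or> \<kappa> = -1"
    and I: "I \<noteq> {}" "open I" "is_interval I"
    and M: "M = {x. lin_coord \<alpha> x \<in> I}"
    and \<psi>: "smooth_on M \<psi>" "depends_only_on \<alpha> M \<psi>" "\<And>x. x \<in> M \<Longrightarrow> \<psi> x \<noteq> 0"
    and f: "smooth_on M f" "depends_only_on \<alpha> M f" "\<And>x. x \<in> M \<Longrightarrow> f x > 0"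
      "\<not> (\<exists>k. \<forall>x\<in>M. f x = k)"
    and scal: "constant_scalar_curvature
      (conformal_change (\<lambda>x. 1 / (\<psi> x)\<^sup>2) (pseudo_euclidean M \<epsilon>))"
    and einst: "einstein
      (warped_product (conformal_change (\<lambda>x. 1 / (\<psi> x)\<^sup>2) (pseudo_euclidean M \<epsilon>)) f N) l"
  shows
    "(ricci_flat
        (warped_product (conformal_change (\<lambda>x. 1 / (\<psi> x)\<^sup>2) (pseudo_euclidean M \<epsilon>)) f N) \<and>
      (\<exists>k. \<forall>x\<in>M. \<psi> x = k) \<and>
      (\<exists>\<Theta> A. \<Theta> > 0 \<and> A \<noteq> 0 \<and> (\<forall>x\<in>M. f x = \<Theta> * exp (A * lin_coord \<alpha> x))))
   \<or> (\<exists>\<Theta> G C. \<Theta> > 0 \<and> G \<noteq> 0 \<and> (\<forall>x\<in>M. lin_coord \<alpha> x \<noteq> C / G) \<and>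
        (\<forall>c \<in> charts (warped_product (pseudo_euclidean M \<epsilon>) (\<lambda>_. \<Theta>) N).
         \<forall>p \<in> chart_dom (warped_product (pseudo_euclidean M \<epsilon>) (\<lambda>_. \<Theta>) N) c.
           metr (warped_product (conformal_change (\<lambda>x. 1 / (\<psi> x)\<^sup>2) (pseudo_euclidean M \<epsilon>)) f N) c p
         = metr (conformal_change (\<lambda>(x, q). 1 / (- G * lin_coord \<alpha> x + C)\<^sup>2)
                  (warped_product (pseudo_euclidean M \<epsilon>) (\<lambda>_. \<Theta>) N)) c p))"
proof -
  let ?S = "conformal_change (\<lambda>x. 1 / (\<psi> x)\<^sup>2) (pseudo_euclidean M \<epsilon>)"
  let ?P = "warped_product ?S f N"
  (* beta is the gradient of the coordinate, up to sign; the line it spans is transverse to the levels *)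
  define \<beta> :: "real^'n" where "\<beta> = (\<chi> k. \<kappa> * \<epsilon> k * \<alpha> $ k)"
  have "lin_coord \<alpha> \<beta> = \<kappa> * (\<Sum>k\<in>UNIV. \<epsilon> k * (\<alpha> $ k)\<^sup>2)"
    unfolding lin_coord_def \<beta>_def sum_distrib_left
    by (rule sum.cong) (simp_all add: power2_eq_square mult_ac)
  also have "\<dots> = 1" unfolding \<kappa>(1) using \<kappa>(2) by auto
  finally have \<beta>: "lin_coord \<alpha> \<beta> = 1" .
  obtain \<Psi> \<Psi>' \<Psi>'' where \<psi>_eq: "\<And>x. x \<in> M \<Longrightarrow> \<psi> x = \<Psi> (lin_coord \<alpha> x)"
    and \<Psi>: "\<And>t. t \<in> I \<Longrightarrow> (\<Psi> has_real_derivative \<Psi>' t) (at t)"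
      "\<And>t. t \<in> I \<Longrightarrow> (\<Psi>' has_real_derivative \<Psi>'' t) (at t)"
    using depends_only_on_profile[OF \<beta> M smooth_on_imp_twice_differentiable_on[OF \<psi>(1)] \<psi>(2)] by metis
  obtain F F' F'' where f_eq: "\<And>x. x \<in> M \<Longrightarrow> f x = F (lin_coord \<alpha> x)"
    and F: "\<And>t. t \<in> I \<Longrightarrow> (F has_real_derivative F' t) (at t)"
      "\<And>t. t \<in> I \<Longrightarrow> (F' has_real_derivative F'' t) (at t)"
    using depends_only_on_profile[OF \<beta> M smooth_on_imp_twice_differentiable_on[OF f(1)] f(2)] by metis
  have line: "t *\<^sub>R \<beta> \<in> M" "lin_coord \<alpha> (t *\<^sub>R \<beta>) = t" if "t \<in> I" for t
    using \<beta> that by (simp_all add: M lin_coord_inner)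
  have \<Psi>0: "\<Psi> t \<noteq> 0" and F0: "F t > 0" if "t \<in> I" for t
    using \<psi>(3) f(3) \<psi>_eq f_eq line[OF that] by metis+
  then have F_nz: "F t \<noteq> 0" if "t \<in> I" for t using that by force

  have manifold: "smooth_manifold N" using N(1) by (simp add: semi_riemannian_manifold_def)
  (* one point of the fibre is enough, since the equations sought concern the base variable only *)
  obtain e q where e: "e \<in> charts N" and q: "q \<in> chart_dom N e"
    by (rule smooth_manifold_has_point[OF manifold])
  note chart = smooth_manifold_chart[OF manifold e]
  define h where "h v = metr N e (chart_inv N e v)" for v
  define V where "V = coord N e ` chart_dom N e"
  have h: "twice_differentiable_on V (\<lambda>v. h v $ a $ b)" for a b
    unfolding h_def V_def using N(1) e
    by (intro smooth_on_imp_twice_differentiable_on) (simp add: semi_riemannian_manifold_def)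
  have nondeg: "invertible (h v)" "transpose (h v) = h v" if v: "v \<in> V" for v
  proof -
    obtain q where q: "q \<in> chart_dom N e" "coord N e q = v" using v unfolding V_def by blast
    then have "h v = metr N e q" unfolding h_def by (simp add: chart_inv_eqI[OF chart(1)])
    then show "invertible (h v)" "transpose (h v) = h v"
      using N(1) e q by (simp_all add: semi_riemannian_manifold_def)
  qed
  interpret ps: plane_warped_product \<epsilon> \<alpha> \<kappa> I \<Psi> \<Psi>' \<Psi>'' F F' F'' h V
    by unfold_locales (use \<epsilon>(1) \<kappa>(1) I(2) \<Psi> \<Psi>0 F F_nz h nondeg chart(2) in \<open>auto simp: V_def\<close>)

  have metr_S: "metr ?S () x = ps.B x" if "x \<in> M" for x
    by (simp add: ps.B_def vec_eq_iff \<psi>_eq[OF that])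
  obtain s where s: "\<And>x. x \<in> M \<Longrightarrow> scalar_curvature ?S () x = s"
    using scal unfolding constant_scalar_curvature_def by auto
  have scalar_ode: "2 * \<Psi> t * \<Psi>'' t - real CARD('n) * (\<Psi>' t)\<^sup>2 = s / (\<kappa> * (real CARD('n) - 1))"
    if t: "t \<in> I" for t
  proof -
    let ?x = "t *\<^sub>R \<beta>"
    have "ricci ?S () ?x = ricci_coords ps.B ?x"
      unfolding ricci_def conformal_pseudo_euclidean_simps
      by (rule ricci_coords_cong[OF open_slab[OF I(2), of \<alpha>]])
        (use line[OF t] metr_S M in \<open>auto simp: chart_inv_conformal_pseudo_euclidean\<close>)
    then have "s = (\<Sum>i\<in>UNIV. \<Sum>j\<in>UNIV. matrix_inv (ps.B ?x) $ i $ j * ricci_coords ps.B ?x $ i $ j)"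
      unfolding s[OF line(1)[OF t], symmetric] scalar_curvature_def metr_S[OF line(1)[OF t]] by simp
    also have "\<dots> = \<kappa> * (real CARD('n) - 1) * (2 * \<Psi> t * \<Psi>'' t - real CARD('n) * (\<Psi>' t)\<^sup>2)"
      by (rule ps.scalar_curvature_B) (use line[OF t] M in auto)
    finally show ?thesis using \<kappa>(2) n by (auto simp: field_simps)
  qed

  let ?y = "\<lambda>t. coord ?P ((), e) (t *\<^sub>R \<beta>, q)"
  have chart_S: "inj_on (coord ?S ()) (chart_dom ?S ())" "open (coord ?S () ` chart_dom ?S ())"
    using open_slab[OF I(2), of \<alpha>] by (simp_all add: inj_on_def M)
  have coords: "ricci ?P ((), e) (t *\<^sub>R \<beta>, q) = ricci_coords ps.wc.G (?y t)"
    "metr ?P ((), e) (t *\<^sub>R \<beta>, q) = ps.wc.G (?y t)"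
    "base_part (?y t) = t *\<^sub>R \<beta>" "fibre_part (?y t) = coord N e q" if t: "t \<in> I" for t
    using ricci_warped_product[OF chart_S(1) chart(1) chart_S(2) chart(2), of ps.B f "\<lambda>x. F (lin_coord \<alpha> x)" "t *\<^sub>R \<beta>" q "?y t"]
      line(1)[OF t] q metr_S f_eq
    by (auto simp: chart_inv_conformal_pseudo_euclidean h_def[abs_def])
  have W: "?y t \<in> ps.wc.W" "t = lin_coord \<alpha> (base_part (?y t))" if "t \<in> I" for t
    unfolding ps.wc.W_def using line[OF that] q by (simp_all add: coords[OF that] V_def that)
  have ein: "ricci_coords ps.wc.G (?y t) = l *\<^sub>R ps.wc.G (?y t)" if "t \<in> I" for t
  proof -
    have "((), e) \<in> charts ?P" "(t *\<^sub>R \<beta>, q) \<in> chart_dom ?P ((), e)"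
      using e q line(1)[OF that] by (simp_all add: warped_product_def)
    then have "ricci ?P ((), e) (t *\<^sub>R \<beta>, q) = l *\<^sub>R metr ?P ((), e) (t *\<^sub>R \<beta>, q)"
      using einst unfolding einstein_def by blast
    then show ?thesis by (simp only: coords[OF that])
  qed
  let ?n = "real CARD('n)" and ?m = "real CARD('m)"
  have base_odes: "(?n - 2) * (\<Psi>'' t / \<Psi> t) = ?m * (F'' t / F t + 2 * (\<Psi>' t / \<Psi> t) * (F' t / F t))"
    "\<Psi> t * \<Psi>'' t - (?n - 1) * (\<Psi>' t)\<^sup>2 + ?m * \<Psi> t * \<Psi>' t * (F' t / F t) = \<kappa> * l" if t: "t \<in> I" for t
  proof -
    let ?A = "(?n - 2) * (\<Psi>'' t / \<Psi> t) - ?m * (F'' t / F t + 2 * (\<Psi>' t / \<Psi> t) * (F' t / F t))"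
    let ?Q = "\<Psi> t * \<Psi>'' t - (?n - 1) * (\<Psi>' t)\<^sup>2 + ?m * \<Psi> t * \<Psi>' t * (F' t / F t)"
    have G: "ps.wc.G (?y t) $ Inl i $ Inl j = (if i = j then \<epsilon> i / (\<Psi> t)\<^sup>2 else 0)" for i j
      using line[OF t] by (simp add: warped_metric_def coords[OF t] ps.B_def)
    have "?A * \<alpha> $ i * \<alpha> $ j + (if i = j then \<epsilon> i * ((\<kappa> * ?Q - l) / (\<Psi> t)\<^sup>2) else 0) = 0" for i j
    proof -
      have "ricci_coords ps.wc.G (?y t) $ Inl i $ Inl j = l * (ps.wc.G (?y t) $ Inl i $ Inl j)"
        by (simp add: ein[OF t])
      then show ?thesis
        unfolding ps.ricci_base_plane[OF W[OF t]] G
        by (cases "i = j") (simp_all add: diff_divide_distrib right_diff_distrib mult.commute[of l])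
    qed
    note tensor = this
    have "2 \<le> CARD('n)" using n by simp
    note vanishing_plane_tensor[OF \<epsilon>(1) \<kappa> this tensor]
    then have "?A = 0" "\<kappa> * ?Q = l" using \<Psi>0[OF t] by auto
    then show "(?n - 2) * (\<Psi>'' t / \<Psi> t) = ?m * (F'' t / F t + 2 * (\<Psi>' t / \<Psi> t) * (F' t / F t))"
      "?Q = \<kappa> * l" using \<kappa>(2) by auto
  qed
  have fibre_ode: "F t * F'' t * (\<Psi> t)\<^sup>2 + (?m - 1) * (F' t)\<^sup>2 * (\<Psi> t)\<^sup>2
      - (?n - 2) * F t * F' t * \<Psi> t * \<Psi>' t = - (\<kappa> * l) * (F t)\<^sup>2" (is "?E = _") if t: "t \<in> I" for t
  proof -
    let ?v = "coord N e q"
    (* the fibre equation is proportional to h, so any nonzero component of h carries it *)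
    have "invertible (h ?v)" using nondeg q by (simp add: V_def)
    then have "h ?v \<noteq> 0" by (metis invertible_det_nz det_0 mat_0)
    then obtain a c where nz: "h ?v $ a $ c \<noteq> 0" by (auto simp: vec_eq_iff)
    have "ricci_coords h ?v = 0"
      using N(2) e q unfolding ricci_flat_def ricci_def h_def[abs_def] by blast
    then have "- \<kappa> * h ?v $ a $ c * ?E = l * ((F t)\<^sup>2 * h ?v $ a $ c)"
      using arg_cong[where f = "\<lambda>A. A $ Inr a $ Inr c", OF ein[OF t]] ps.ricci_fibre_plane[OF W[OF t], of a c] line[OF t]
      by (simp add: warped_metric_def coords[OF t])
    then have "h ?v $ a $ c * (- \<kappa> * ?E) = h ?v $ a $ c * (l * (F t)\<^sup>2)" by (simp add: mult_ac)
    then have "- \<kappa> * ?E = l * (F t)\<^sup>2" using nz mult_left_cancel by blast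
    then show ?thesis using \<kappa>(2) by auto
  qed
  have F_nonconst: "\<not> (\<exists>k. \<forall>t\<in>I. F t = k)"
    using f(4) f_eq M by auto
  have nm: "?n > 2" "?m > 1" using n m by simp_all
  obtain a \<Theta> d where sol: "a \<noteq> 0" "\<Theta> > 0" "\<And>t. t \<in> I \<Longrightarrow> \<Psi> t = a * t + d" "\<And>t. t \<in> I \<Longrightarrow> F t * \<bar>\<Psi> t\<bar> = \<Theta>"
    by (rule einstein_profile_odes[OF I nm \<Psi> \<Psi>0 F F0 F_nonconst base_odes fibre_ode scalar_ode]) (blast intro: that)+
  have psi: "\<psi> x = a * lin_coord \<alpha> x + d" if "x \<in> M" for x
    using sol(3)[of "lin_coord \<alpha> x"] \<psi>_eq[OF that] that M by simp
  have f2: "(f x)\<^sup>2 = 1 / (a * lin_coord \<alpha> x + d)\<^sup>2 * \<Theta>\<^sup>2" if x: "x \<in> M" for x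
  proof -
    have "f x * \<bar>\<psi> x\<bar> = \<Theta>" using sol(4) \<psi>_eq[OF x] f_eq[OF x] x M by simp
    then have "(f x)\<^sup>2 * (\<psi> x)\<^sup>2 = \<Theta>\<^sup>2" by (metis power_mult_distrib power2_abs)
    then show ?thesis using \<psi>(3)[OF x] psi[OF x] by (simp add: field_simps)
  qed
  have "metr ?P c p = metr (conformal_change (\<lambda>(x, q). 1 / (- (- a) * lin_coord \<alpha> x + d)\<^sup>2)
      (warped_product (pseudo_euclidean M \<epsilon>) (\<lambda>_. \<Theta>) N)) c p"
    if "p \<in> chart_dom (warped_product (pseudo_euclidean M \<epsilon>) (\<lambda>_. \<Theta>) N) c" for c p
  proof -
    obtain u e x q where [simp]: "c = (u, e)" "p = (x, q)" by (cases c, cases p)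
    have x: "x \<in> M" using that by (simp add: warped_product_def pseudo_euclidean_def)
    show ?thesis
      by (auto simp: conformal_change_def warped_product_def pseudo_euclidean_def vec_eq_iff
          psi[OF x] f2[OF x] split: sum.split)
  qed
  moreover have "lin_coord \<alpha> x \<noteq> d / (- a)" if "x \<in> M" for x
    using psi[OF that] \<psi>(3)[OF that] sol(1) by (auto simp: field_simps)
  ultimately show ?thesis using sol(1,2)
    by (intro disjI2 exI[of _ \<Theta>] exI[of _ "- a"] exI[of _ d]) auto
qed

end
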